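(* Let $G$ be a countable infinite discrete group and let $T$ be the nonsingular $(C,F)$-action of $G$ associated with admissible $(C,F)$-parameters $\mathcal T=(C_n,F_{n-1},\kappa_n,\nu_{n-1})_{n\ge1}$. Then $T$ is totally ergodic if no telescoping of $\mathcal T$ is compatible with any proper finite-index subgroup of $G$, i.e. if for each increasing sequence $n_1<n_2<\cdots$ of positive integers and each proper finite-index subgroup $\Gamma$ of $G$, $$\sum_{k=1}^\infty\kappa_{n_k+1}*\cdots*\kappa_{n_{k+1}}\big(\{c\in C_{n_k+1}\cdots C_{n_{k+1}}: c\notin\Gamma\}\big)=\infty.$$
   Context: A nonsingular $G$-action is totally ergodic if every finite-index subgroup of $G$ acts ergodically (equivalently, it has no non-trivial finite factors). $*$ is convolution of measures on $G$. **$(C,F)$-parameters.** $\mathcal T=(C_n,F_{n-1},\kappa_n,\nu_{n-1})_{n\ge1}$, where $C_n,F_n$ are finite subsets of $G$, $F_0=\{1_G\}$, $1_G\in F_n\cap C_n$ and $\#C_n>1$ for $n\ge 1$; $F_nC_{n+1}\subset F_{n+1}$ and $F_nc\cap F_nc'=\emptyset$ for distinct $c,c'\in C_{n+1}$, $n\ge0$; $\kappa_n$ is a probability on $C_n$ with full support, with $\prod_{n>0}\max_{c\in C_n}\kappa_n(c)=0$; $\nu_n$ is a finite measure on $F_n$ with full support, $\nu_0(1_G)=1$ and $\nu_{n+1}(fc)=\nu_n(f)\kappa_{n+1}(c)$ for $f\in F_n$, $c\in C_{n+1}$. They are admissible if for all $g\in G$, $n\ge0$: $\lim_{m\to\infty}\nu_m\big((F_nC_{n+1}\cdots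 C_m)\cap g^{-1}F_m\big)=\nu_n(F_n)$. **$(C,F)$-action.** Let $X_n=F_n\times C_{n+1}\times C_{n+2}\times\cdots$ (product topology), embedded into $X_{n+1}$ by $(f_n,c_{n+1},c_{n+2},\dots)\mapsto(f_nc_{n+1},c_{n+2},\dots)$, and let $X$ be the inductive limit (increasing union) of the $X_n$. For $f\in F_n$ let $[f]_n\subset X_n\subset X$ be the set of points of $X_n$ with first coordinate $f$. $\mu$ is the $\sigma$-finite Borel measure on $X$ with $\mu([f]_n)=\nu_n(f)$ for all $f\in F_n$, $n\ge0$. For $g\in G$ let $X^g=\bigcup_{n\ge0}\{(f_n,c_{n+1},\dots)\in X_n: gf_n\in F_n\}$ and $X^G=\bigcap_{g\in G}X^g$. For $x\in X^G$ set $T_gx=(gf_n,c_{n+1},\dots)\in X_n$, where $n$ is such that $x=(f_n,c_{n+1},\dots)\in X_n$ and $gf_n\in F_n$. Admissibility is equivalent to $\mu(X\setminus X^G)=0$, and then $(X,\mu,T)$ is the nonsingular $(C,F)$-action associated with $\mathcal T$. *)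

theory Defs
  imports "HOL-Algebra.Coset" "HOL-Probability.Probability"
begin

section \<open>Products and convolutions in a discrete group\<close>

(* C (Suc a) C (a + 2) ... C b; the set {\<one>} if b \<le> a *)
definition set_product :: "('a, 'm) monoid_scheme \<Rightarrow> (nat \<Rightarrow> 'a set) \<Rightarrow> nat \<Rightarrow> nat \<Rightarrow> 'a set" where
  "set_product G C a b = foldr (\<lambda>i S. C i <#>\<^bsub>G\<^esub> S) [Suc a..<Suc b] {\<one>\<^bsub>G\<^esub>}"

definition convolve_pmf :: "('a, 'm) monoid_scheme \<Rightarrow> 'a pmf \<Rightarrow> 'a pmf \<Rightarrow> 'a pmf" where
  "convolve_pmf G p q = map_pmf (\<lambda>(x, y). x \<otimes>\<^bsub>G\<^esub> y) (pair_pmf p q)"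

(* \<kappa> (Suc a) * \<kappa> (a + 2) * ... * \<kappa> b; the unit mass at \<one> if b \<le> a *)
definition convolution_product ::
    "('a, 'm) monoid_scheme \<Rightarrow> (nat \<Rightarrow> 'a pmf) \<Rightarrow> nat \<Rightarrow> nat \<Rightarrow> 'a pmf" where
  "convolution_product G \<kappa> a b =
     foldr (\<lambda>i p. convolve_pmf G (\<kappa> i) p) [Suc a..<Suc b] (return_pmf \<one>\<^bsub>G\<^esub>)"


section \<open>\<open>(C,F)\<close>-parameters\<close>

(* The values C 0 and \<kappa> 0 are never used.  The finite measure \<nu> n on F n is given by its point
   masses; values outside F n are irrelevant. *)
locale cf_parameters = group G for G :: "('a, 'm) monoid_scheme" (structure) +
  fixes C F :: "nat \<Rightarrow> 'a set" and \<kappa> :: "nat \<Rightarrow> 'a pmf" and \<nu> :: "nat \<Rightarrow> 'a \<Rightarrow> real"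
  assumes C_subset: "n \<ge> 1 \<Longrightarrow> C n \<subseteq> carrier G"
    and C_finite: "n \<ge> 1 \<Longrightarrow> finite (C n)"
    and F_subset: "F n \<subseteq> carrier G"
    and F_finite: "finite (F n)"
    and F_0: "F 0 = {\<one>}"
    and one_in: "n \<ge> 1 \<Longrightarrow> \<one> \<in> F n \<inter> C n"
    and C_card: "n \<ge> 1 \<Longrightarrow> card (C n) > 1"
    and F_C_subset: "F n <#> C (Suc n) \<subseteq> F (Suc n)"
    and F_C_disjoint:
      "c \<in> C (Suc n) \<Longrightarrow> c' \<in> C (Suc n) \<Longrightarrow> c \<noteq> c' \<Longrightarrow> (F n #> c) \<inter> (F n #> c') = {}"
    and \<kappa>_support: "n \<ge> 1 \<Longrightarrow> set_pmf (\<kappa> n) = C n"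
    and \<kappa>_product: "(\<lambda>N. \<Prod>n = 1..N. Max (pmf (\<kappa> n) ` C n)) \<longlonglongrightarrow> 0"
    and \<nu>_support: "f \<in> F n \<Longrightarrow> \<nu> n f > 0"
    and \<nu>_0: "\<nu> 0 \<one> = 1"
    and \<nu>_Suc: "f \<in> F n \<Longrightarrow> c \<in> C (Suc n) \<Longrightarrow> \<nu> (Suc n) (f \<otimes> c) = \<nu> n f * pmf (\<kappa> (Suc n)) c"

definition cf_admissible ::
    "('a, 'm) monoid_scheme \<Rightarrow> (nat \<Rightarrow> 'a set) \<Rightarrow> (nat \<Rightarrow> 'a set) \<Rightarrow> (nat \<Rightarrow> 'a \<Rightarrow> real) \<Rightarrow> bool" where
  "cf_admissible G C F \<nu> \<longleftrightarrow>
     (\<forall>g \<in> carrier G. \<forall>n.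
       (\<lambda>m. \<Sum>f \<in> (F n <#>\<^bsub>G\<^esub> set_product G C n m) \<inter> (inv\<^bsub>G\<^esub> g <#\<^bsub>G\<^esub> F m). \<nu> m f)
         \<longlonglongrightarrow> (\<Sum>f \<in> F n. \<nu> n f))"


section \<open>The space \<open>X\<close> as an inductive limit\<close>

(* A point (f_n, c_(n+1), c_(n+2), ...) of X_n is the extensional function x on {n..} with
   x n = f_n and x m = c_m for m > n. *)
definition cf_level_topology :: "(nat \<Rightarrow> 'a set) \<Rightarrow> (nat \<Rightarrow> 'a set) \<Rightarrow> nat \<Rightarrow> (nat \<Rightarrow> 'a) topology" where
  "cf_level_topology C F n =
     product_topology (\<lambda>m. discrete_topology (if m = n then F n else C m)) {n..}"

definition cf_level :: "(nat \<Rightarrow> 'a set) \<Rightarrow> (nat \<Rightarrow> 'a set) \<Rightarrow> nat \<Rightarrow> (nat \<Rightarrow> 'a) set" where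
  "cf_level C F n = (\<Pi>\<^sub>E m\<in>{n..}. if m = n then F n else C m)"

lemma topspace_cf_level_topology: "topspace (cf_level_topology C F n) = cf_level C F n"
  by (simp add: cf_level_topology_def cf_level_def)

definition cf_step :: "('a, 'm) monoid_scheme \<Rightarrow> nat \<Rightarrow> (nat \<Rightarrow> 'a) \<Rightarrow> nat \<Rightarrow> 'a" where
  "cf_step G n x = (\<lambda>m\<in>{Suc n..}. if m = Suc n then x n \<otimes>\<^bsub>G\<^esub> x (Suc n) else x m)"

(* the composite embedding of X_n into X_(n + d) *)
primrec cf_embed :: "('a, 'm) monoid_scheme \<Rightarrow> nat \<Rightarrow> nat \<Rightarrow> (nat \<Rightarrow> 'a) \<Rightarrow> nat \<Rightarrow> 'a" where
  "cf_embed G n 0 x = x"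
| "cf_embed G n (Suc d) x = cf_step G (n + d) (cf_embed G n d x)"

definition cf_equiv ::
    "('a, 'm) monoid_scheme \<Rightarrow> (nat \<Rightarrow> 'a set) \<Rightarrow> (nat \<Rightarrow> 'a set) \<Rightarrow> (nat \<times> (nat \<Rightarrow> 'a)) rel" where
  "cf_equiv G C F =
     {((n, x), (m, y)). x \<in> cf_level C F n \<and> y \<in> cf_level C F m \<and>
        (\<exists>d e. n + d = m + e \<and> cf_embed G n d x = cf_embed G m e y)}"

type_synonym 'a cf_point = "(nat \<times> (nat \<Rightarrow> 'a)) set"

definition cf_space ::
    "('a, 'm) monoid_scheme \<Rightarrow> (nat \<Rightarrow> 'a set) \<Rightarrow> (nat \<Rightarrow> 'a set) \<Rightarrow> 'a cf_point set" where
  "cf_space G C F = (SIGMA n:UNIV. cf_level C F n) // cf_equiv G C F"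

(* the inclusion of X_n into X *)
definition cf_incl ::
    "('a, 'm) monoid_scheme \<Rightarrow> (nat \<Rightarrow> 'a set) \<Rightarrow> (nat \<Rightarrow> 'a set) \<Rightarrow> nat \<Rightarrow> (nat \<Rightarrow> 'a) \<Rightarrow> 'a cf_point" where
  "cf_incl G C F n x = cf_equiv G C F `` {(n, x)}"

definition cf_open ::
    "('a, 'm) monoid_scheme \<Rightarrow> (nat \<Rightarrow> 'a set) \<Rightarrow> (nat \<Rightarrow> 'a set) \<Rightarrow> 'a cf_point set \<Rightarrow> bool" where
  "cf_open G C F U \<longleftrightarrow> U \<subseteq> cf_space G C F \<and>
     (\<forall>n. openin (cf_level_topology C F n) {x \<in> cf_level C F n. cf_incl G C F n x \<in> U})"

definition cf_topology ::
    "('a, 'm) monoid_scheme \<Rightarrow> (nat \<Rightarrow> 'a set) \<Rightarrow> (nat \<Rightarrow> 'a set) \<Rightarrow> 'a cf_point topology" where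
  "cf_topology G C F = topology (cf_open G C F)"

lemma openin_cf_topology: "openin (cf_topology G C F) U \<longleftrightarrow> cf_open G C F U"
proof -
  have "istopology (cf_open G C F)"
    unfolding istopology_def
  proof safe
    fix S T assume "cf_open G C F S" "cf_open G C F T"
    moreover have "{x \<in> cf_level C F n. cf_incl G C F n x \<in> S \<inter> T} =
        {x \<in> cf_level C F n. cf_incl G C F n x \<in> S} \<inter> {x \<in> cf_level C F n. cf_incl G C F n x \<in> T}" for n
      by blast
    ultimately show "cf_open G C F (S \<inter> T)"
      unfolding cf_open_def by (auto intro: openin_Int)
  next
    fix \<K> assume "\<forall>K\<in>\<K>. cf_open G C F K"
    moreover have "{x \<in> cf_level C F n. cf_incl G C F n x \<in> \<Union>\<K>} =
        (\<Union>K\<in>\<K>. {x \<in> cf_level C F n. cf_incl G C F n x \<in> K})" for n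
      by blast
    ultimately show "cf_open G C F (\<Union>\<K>)"
      unfolding cf_open_def by (auto intro!: openin_Union)
  qed
  then show ?thesis
    by (simp add: cf_topology_def)
qed

definition cf_cylinder ::
    "('a, 'm) monoid_scheme \<Rightarrow> (nat \<Rightarrow> 'a set) \<Rightarrow> (nat \<Rightarrow> 'a set) \<Rightarrow> nat \<Rightarrow> 'a \<Rightarrow> 'a cf_point set" where
  "cf_cylinder G C F n f = cf_incl G C F n ` {x \<in> cf_level C F n. x n = f}"

(* These conditions determine \<mu> uniquely. *)
definition cf_measure ::
    "('a, 'm) monoid_scheme \<Rightarrow> (nat \<Rightarrow> 'a set) \<Rightarrow> (nat \<Rightarrow> 'a set) \<Rightarrow> (nat \<Rightarrow> 'a \<Rightarrow> real) \<Rightarrow>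
      'a cf_point measure \<Rightarrow> bool" where
  "cf_measure G C F \<nu> \<mu> \<longleftrightarrow>
     space \<mu> = cf_space G C F \<and>
     sets \<mu> = sigma_sets (cf_space G C F) {U. openin (cf_topology G C F) U} \<and>
     sigma_finite_measure \<mu> \<and>
     (\<forall>n. \<forall>f \<in> F n. emeasure \<mu> (cf_cylinder G C F n f) = ennreal (\<nu> n f))"


section \<open>The \<open>(C,F)\<close>-action\<close>

definition cf_domain ::
    "('a, 'm) monoid_scheme \<Rightarrow> (nat \<Rightarrow> 'a set) \<Rightarrow> (nat \<Rightarrow> 'a set) \<Rightarrow> 'a \<Rightarrow> 'a cf_point set" where
  "cf_domain G C F g =
     (\<Union>n. cf_incl G C F n ` {x \<in> cf_level C F n. g \<otimes>\<^bsub>G\<^esub> x n \<in> F n})"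

definition cf_full_domain ::
    "('a, 'm) monoid_scheme \<Rightarrow> (nat \<Rightarrow> 'a set) \<Rightarrow> (nat \<Rightarrow> 'a set) \<Rightarrow> 'a cf_point set" where
  "cf_full_domain G C F = (\<Inter>g\<in>carrier G. cf_domain G C F g)"

(* For p in cf_domain G C F g the described point exists and does not depend on the choice of n. *)
definition cf_action ::
    "('a, 'm) monoid_scheme \<Rightarrow> (nat \<Rightarrow> 'a set) \<Rightarrow> (nat \<Rightarrow> 'a set) \<Rightarrow> 'a \<Rightarrow> 'a cf_point \<Rightarrow> 'a cf_point" where
  "cf_action G C F g p =
     (THE q. \<exists>n. \<exists>x \<in> cf_level C F n. g \<otimes>\<^bsub>G\<^esub> x n \<in> F n \<and>
        p = cf_incl G C F n x \<and> q = cf_incl G C F n (x(n := g \<otimes>\<^bsub>G\<^esub> x n)))"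


section \<open>Ergodicity\<close>

(* Invariance of A is understood modulo null sets. *)
definition ergodic_action :: "'x measure \<Rightarrow> 'a set \<Rightarrow> ('a \<Rightarrow> 'x \<Rightarrow> 'x) \<Rightarrow> bool" where
  "ergodic_action M H T \<longleftrightarrow>
     (\<forall>A \<in> sets M. (\<forall>h \<in> H. AE x in M. T h x \<in> A \<longleftrightarrow> x \<in> A) \<longrightarrow>
        A \<in> null_sets M \<or> space M - A \<in> null_sets M)"

definition totally_ergodic ::
    "('a, 'm) monoid_scheme \<Rightarrow> 'x measure \<Rightarrow> ('a \<Rightarrow> 'x \<Rightarrow> 'x) \<Rightarrow> bool" where
  "totally_ergodic G M T \<longleftrightarrow>
     (\<forall>H. subgroup H G \<and> finite (rcosets\<^bsub>G\<^esub> H) \<longrightarrow> ergodic_action M H T)"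

end

theory Submission
  imports Defs
begin

text \<open>
  Let \<open>H\<close> be a finite-index subgroup and let \<open>A \<subseteq> X\<^sup>G\<close> be \<open>H\<close>-invariant and not null. The map
  \<open>\<phi> p = {g. T g p \<in> A}\<close> takes finitely many values, because each of them is a union of right cosets of
  \<open>H\<close>, and \<open>\<phi> (T f p) = \<phi> p f\<inverse>\<close>. Let \<open>P n U\<close> be the conditional probability of \<open>\<phi> = U\<close> given
  \<open>[\<one>]\<^sub>n\<close>. Since \<open>T f\<close> maps \<open>[\<one>]\<^sub>n\<close> to \<open>[f]\<^sub>n\<close> and rescales \<open>\<mu>\<close> by a constant there, the conditional
  probability of \<open>\<phi> = U\<close> given \<open>[f]\<^sub>n\<close> is \<open>P n (U f)\<close>. Hence \<open>P n U\<close> is the mean of \<open>P m (U f)\<close> for \<open>f\<close>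
  distributed according to \<open>\<kappa>\<^sub>n\<^sub>+\<^sub>1 * \<dots> * \<kappa>\<^sub>m\<close>.

  By a density argument, \<open>P n\<close> concentrates on one value as \<open>n\<close> grows, and by the pigeonhole principle
  it concentrates on the same set \<open>a\<close> along a subsequence \<open>n\<^sub>k\<close>. If the stabilizer \<open>\<Gamma> = {g. a g = a}\<close>
  were proper, then \<open>f \<notin> \<Gamma>\<close> would make \<open>P m (a f)\<close> small, so that the convolution identity bounds
  the mass outside \<open>\<Gamma>\<close> by a multiple of \<open>1 - P (n\<^sub>k) a\<close>; the telescoping \<open>n\<^sub>k\<close> can be chosen such
  that this is summable. So \<open>\<Gamma> = G\<close>; then \<open>\<phi> = a\<close> almost everywhere, \<open>a\<close> contains \<open>\<one>\<close>, and \<open>A\<close> is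
  conull.
\<close>

section \<open>Coordinates on the inductive limit\<close>

context cf_parameters
begin

abbreviation "level \<equiv> cf_level C F"
abbreviation "incl \<equiv> cf_incl G C F"
abbreviation "cyl \<equiv> cf_cylinder G C F"

section \<open>Levels, their embeddings and the gluing relation\<close>

lemma F_carrier: "f \<in> F n \<Longrightarrow> f \<in> carrier G"
  using F_subset by blast

lemma C_carrier: "c \<in> C (Suc n) \<Longrightarrow> c \<in> carrier G"
  using C_subset[of "Suc n"] by auto

lemma F_C_mult: "f \<in> F n \<Longrightarrow> c \<in> C (Suc n) \<Longrightarrow> f \<otimes> c \<in> F (Suc n)"
  using F_C_subset[of n] by (auto simp: set_mult_def)

lemma one_F: "\<one> \<in> F n"
  using F_0 one_in[of n] by (cases n) auto

text \<open>Translates of \<open>F n\<close> by distinct elements of \<open>C (Suc n)\<close> are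
  disjoint, so the product determines \<open>c\<close>; the rest is cancellation in the group. This
  is what makes the embeddings of the levels injective.\<close>

lemma F_C_cancel:
  assumes "f \<in> F n" "c \<in> C (Suc n)" "f' \<in> F n" "c' \<in> C (Suc n)" "f \<otimes> c = f' \<otimes> c'"
  shows "f = f' \<and> c = c'"
proof -
  have "f \<otimes> c \<in> (F n #> c) \<inter> (F n #> c')"
    using assms unfolding r_coset_def by blast
  then have "c = c'"
    using F_C_disjoint assms by blast
  then show ?thesis
    using assms F_carrier C_carrier right_cancel by metis
qed

lemma level_iff:
  "x \<in> level n \<longleftrightarrow> x \<in> extensional {n..} \<and> x n \<in> F n \<and> (\<forall>m>n. x m \<in> C m)"
  unfolding cf_level_def PiE_iff by (force simp: le_less)

lemma level_C: "x \<in> level n \<Longrightarrow> n \<le> m \<Longrightarrow> x (Suc m) \<in> C (Suc m)"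
  by (auto simp: level_iff)

lemma step_level:
  assumes "x \<in> level n"
  shows "cf_step G n x \<in> level (Suc n)"
  using assms F_C_mult by (auto simp: level_iff cf_step_def)

lemma step_inj:
  assumes x: "x \<in> level n" and y: "y \<in> level n" and eq: "cf_step G n x = cf_step G n y"
  shows "x = y"
proof
  fix m
  have *: "cf_step G n x k = cf_step G n y k" for k
    using eq by simp
  have 1: "x n = y n \<and> x (Suc n) = y (Suc n)"
    using *[of "Suc n"] x y by (intro F_C_cancel) (auto simp: level_iff cf_step_def)
  consider "m < n" | "m = n" | "m = Suc n" | "m > Suc n"
    by linarith
  then show "x m = y m"
  proof cases
    case 1
    then show ?thesis
      using x y by (auto simp: level_iff extensional_def)
  qed (use 1 *[of m] in \<open>auto simp: cf_step_def\<close>)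
qed

lemma embed_level: "x \<in> level n \<Longrightarrow> cf_embed G n d x \<in> level (n + d)"
  by (induction d) (auto intro: step_level)

lemma embed_inj:
  "x \<in> level n \<Longrightarrow> y \<in> level n \<Longrightarrow> cf_embed G n d x = cf_embed G n d y \<Longrightarrow> x = y"
  by (induction d) (auto dest: step_inj[OF embed_level embed_level])

lemma embed_add: "cf_embed G n (d + e) x = cf_embed G (n + d) e (cf_embed G n d x)"
  by (induction e) (auto simp: add.assoc)

lemma embed_above: "i > n + d \<Longrightarrow> cf_embed G n d x i = x i"
  by (induction d) (auto simp: cf_step_def)

lemma equiv_cf_equiv: "equiv (SIGMA n:UNIV. level n) (cf_equiv G C F)"
proof (rule equivI)
  show "cf_equiv G C F \<subseteq> (SIGMA n:UNIV. level n) \<times> (SIGMA n:UNIV. level n)"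
    by (auto simp: cf_equiv_def)
  show "refl_on (SIGMA n:UNIV. level n) (cf_equiv G C F)"
    by (auto simp: refl_on_def cf_equiv_def)
  show "sym (cf_equiv G C F)"
    by (auto simp: sym_def cf_equiv_def) metis
  show "trans (cf_equiv G C F)"
  proof (rule transI)
    fix p q r
    assume "(p, q) \<in> cf_equiv G C F" "(q, r) \<in> cf_equiv G C F"
    then obtain n x m y k z d e d' e' where *: "p = (n, x)" "q = (m, y)" "r = (k, z)"
        "x \<in> level n" "y \<in> level m" "z \<in> level k"
        "n + d = m + e" "cf_embed G n d x = cf_embed G m e y"
        "m + d' = k + e'" "cf_embed G m d' y = cf_embed G k e' z"
      unfolding cf_equiv_def by fastforce
    \<comment> \<open>Both given equalities are pushed on to a common level: the first by
      \<open>d'\<close> further steps, the second by \<open>e\<close> further steps.\<close>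
    have "cf_embed G n (d + d') x = cf_embed G m (d' + e) y"
      using * by (metis embed_add add.commute)
    also have "\<dots> = cf_embed G k (e' + e) z"
      using * by (metis embed_add)
    finally have "cf_embed G n (d + d') x = cf_embed G k (e' + e) z" .
    moreover have "n + (d + d') = k + (e' + e)"
      using * by linarith
    ultimately show "(p, r) \<in> cf_equiv G C F"
      using * unfolding cf_equiv_def by blast
  qed
qed

section \<open>Points of the inductive limit and their coordinates\<close>

lemma incl_eq_iff:
  assumes "x \<in> level n" "y \<in> level m"
  shows "incl n x = incl m y \<longleftrightarrow> (\<exists>d e. n + d = m + e \<and> cf_embed G n d x = cf_embed G m e y)"
proof -
  have "incl n x = incl m y \<longleftrightarrow> ((n, x), (m, y)) \<in> cf_equiv G C F"
    unfolding cf_incl_def using assms by (intro eq_equiv_class_iff[OF equiv_cf_equiv]) auto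
  then show ?thesis
    using assms by (auto simp: cf_equiv_def)
qed

lemma incl_inj:
  assumes "x \<in> level n" "y \<in> level n" "incl n x = incl n y"
  shows "x = y"
  using assms embed_inj by (auto simp: incl_eq_iff)

lemma incl_step:
  assumes "x \<in> level n"
  shows "incl n x = incl (Suc n) (cf_step G n x)"
proof -
  have "n + 1 = Suc n + 0 \<and> cf_embed G n 1 x = cf_embed G (Suc n) 0 (cf_step G n x)"
    by simp
  then show ?thesis
    using incl_eq_iff[OF assms step_level[OF assms]] by blast
qed

text \<open>\<open>stage n\<close> is \<open>X\<^sub>n\<close> as a subset of \<open>X\<close>; \<open>coord n p\<close> is the first coordinate \<open>f\<^sub>n\<close> of a point \<open>p\<close> of
  \<open>X\<^sub>n\<close> and meaningless elsewhere.\<close>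

definition stage :: "nat \<Rightarrow> 'a cf_point set" where
  "stage n = incl n ` level n"

definition coord :: "nat \<Rightarrow> 'a cf_point \<Rightarrow> 'a" where
  "coord n p = inv_into (level n) (incl n) p n"

lemma coord_incl: "x \<in> level n \<Longrightarrow> coord n (incl n x) = x n"
  unfolding coord_def by (subst inv_into_f_f) (auto intro: inj_onI incl_inj)

lemma incl_stage: "x \<in> level n \<Longrightarrow> incl n x \<in> stage n"
  by (simp add: stage_def)

lemma stageE:
  assumes "p \<in> stage n"
  obtains x where "x \<in> level n" "p = incl n x" "coord n p = x n"
  using assms coord_incl unfolding stage_def by blast

lemma space_eq: "cf_space G C F = (\<Union>n. stage n)"
  unfolding cf_space_def quotient_def stage_def cf_incl_def by force

lemma stage_Suc: "p \<in> stage n \<Longrightarrow> p \<in> stage (Suc n)"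
  by (metis incl_stage incl_step stageE step_level)

lemma stage_mono: "p \<in> stage n \<Longrightarrow> n \<le> m \<Longrightarrow> p \<in> stage m"
  by (rule dec_induct[of n m]) (auto intro: stage_Suc)

lemma coord_F: "p \<in> stage n \<Longrightarrow> coord n p \<in> F n"
  by (metis level_iff stageE)

lemma coord_carrier: "p \<in> stage n \<Longrightarrow> coord n p \<in> carrier G"
  using coord_F F_carrier by blast

lemma incl_embed: "x \<in> level n \<Longrightarrow> incl n x = incl (n + d) (cf_embed G n d x)"
  by (induction d) (auto simp: incl_step[OF embed_level])

text \<open>The embeddings multiply the entries of \<open>x\<close> into the first coordinate one
  after another, so \<open>coord m\<close> is the partial product
  \<open>x n \<otimes> ... \<otimes> x m\<close>; the embedding into level \<open>m\<close> has not
  yet touched the entry \<open>x (Suc m)\<close>.\<close>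

lemma coord_Suc_incl:
  assumes "x \<in> level n" "n \<le> m"
  shows "coord (Suc m) (incl n x) = coord m (incl n x) \<otimes> x (Suc m)"
proof -
  obtain d where m: "m = n + d"
    using assms(2) le_Suc_ex by blast
  let ?y = "cf_embed G n d x"
  have y: "?y \<in> level m"
    using assms m embed_level by simp
  have "incl n x = incl m ?y" "incl n x = incl (Suc m) (cf_step G m ?y)"
    using incl_embed[OF assms(1)] incl_step[OF y] m by auto
  then show ?thesis
    using coord_incl[OF y] coord_incl[OF step_level[OF y]] m embed_above[of n d "Suc m" x]
    by (simp add: cf_step_def)
qed

lemma coord_Suc:
  assumes "p \<in> stage n"
  obtains c where "c \<in> C (Suc n)" "coord (Suc n) p = coord n p \<otimes> c"
  by (metis assms coord_Suc_incl le_refl level_C stageE)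

text \<open>Consecutive coordinates differ by one entry on the right, so by cancellation the
  coordinates recover all entries. This reduces equality of points to equality of group
  elements.\<close>

lemma point_eqI:
  assumes p: "p \<in> stage n" and q: "q \<in> stage n" and eq: "\<And>m. n \<le> m \<Longrightarrow> coord m p = coord m q"
  shows "p = q"
proof -
  obtain x y where x: "x \<in> level n" "p = incl n x" and y: "y \<in> level n" "q = incl n y"
    using p q stageE by metis
  have "x m = y m" for m
  proof -
    consider "m < n" | "m = n" | k where "m = Suc k" "n \<le> k"
      by (metis less_Suc_eq_le not_less_iff_gr_or_eq old.nat.exhaust less_nat_zero_code)
    then show ?thesis
    proof cases
      case 1
      then show ?thesis
        using x y by (auto simp: level_iff extensional_def)
    next
      case 2
      then show ?thesis
        using eq[of n] x y coord_incl by auto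
    next
      case (3 k)
      then have "coord k p \<otimes> x m = coord k p \<otimes> y m"
        using eq[of k] eq[of m] x y coord_Suc_incl by auto
      moreover have "coord k p \<in> carrier G"
        using p 3 coord_carrier stage_mono by blast
      ultimately show ?thesis
        using 3 x y level_C C_carrier by (metis Units_eq Units_l_cancel)
    qed
  qed
  then have "x = y"
    by (rule ext)
  then show ?thesis
    using x y by simp
qed

text \<open>The coordinate of \<open>p\<close> at level \<open>Suc n\<close> is a product of an
  element of \<open>F n\<close> and one of \<open>C (Suc n)\<close>, and the same splitting can be
  applied to any point with that coordinate.\<close>

lemma stage_back_Suc:
  assumes p: "p \<in> stage n" and q: "q \<in> stage (Suc n)" and eq: "coord (Suc n) p = coord (Suc n) q"
  shows "q \<in> stage n \<and> coord n q = coord n p"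
proof -
  obtain x where x: "x \<in> level n" "p = incl n x" "coord n p = x n"
    using p stageE by blast
  obtain y where y: "y \<in> level (Suc n)" "q = incl (Suc n) y" "coord (Suc n) q = y (Suc n)"
    using q stageE by blast
  \<comment> \<open>\<open>z\<close> replaces the first entry of \<open>y\<close> by the two entries
    of \<open>x\<close> whose product it is, and keeps the later entries of
    \<open>y\<close>.\<close>
  define z where "z = (\<lambda>m\<in>{n..}. if m \<le> Suc n then x m else y m)"
  have z: "z \<in> level n"
    using x y by (auto simp: level_iff z_def)
  have "cf_step G n z = y"
  proof
    fix m
    have "y (Suc n) = x n \<otimes> x (Suc n)"
      using eq x y coord_Suc_incl[OF x(1) order.refl] by simp
    then show "cf_step G n z m = y m"
      using y by (auto simp: cf_step_def z_def level_iff extensional_def)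
  qed
  then have "q = incl n z"
    using incl_step[OF z] y by simp
  moreover have "z n = x n"
    by (simp add: z_def)
  ultimately show ?thesis
    using z x coord_incl incl_stage by auto
qed

lemma stage_back:
  assumes "p \<in> stage n" "n \<le> m" "q \<in> stage m" "coord m p = coord m q"
  shows "q \<in> stage n \<and> coord n q = coord n p"
  using assms(2-4)
proof (induction m arbitrary: q rule: dec_induct)
  case base
  then show ?case by simp
next
  case (step m)
  then have "q \<in> stage m" "coord m q = coord m p"
    using stage_back_Suc[of p m q] stage_mono[OF assms(1), of m] by blast+
  then show ?case
    using step.IH[of q] by presburger
qed

section \<open>Cylinders and their refinement\<close>

lemma cyl_eq: "cyl n f = {p \<in> stage n. coord n p = f}"
  unfolding cf_cylinder_def stage_def using coord_incl by auto

lemma cyl_refine: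
  assumes "p \<in> stage n" "n \<le> m"
  shows "cyl m (coord m p) \<subseteq> cyl n (coord n p)"
  using stage_back[OF assms] stage_mono by (auto simp: cyl_eq)

lemma ex_coord_Suc:
  assumes "f \<in> F n" "c \<in> C (Suc n)"
  obtains p where "p \<in> stage n" "coord n p = f" "coord (Suc n) p = f \<otimes> c"
proof -
  define x where "x = (\<lambda>m\<in>{n..}. if m = n then f else if m = Suc n then c else \<one>)"
  have x: "x \<in> level n"
    using assms one_in by (auto simp: level_iff x_def)
  show thesis
    by (rule that[of "incl n x"])
      (use x coord_incl[OF x] coord_Suc_incl[OF x order.refl] in \<open>auto simp: incl_stage x_def\<close>)
qed

lemma cyl_Suc:
  assumes "f \<in> F n"
  shows "cyl n f = (\<Union>c\<in>C (Suc n). cyl (Suc n) (f \<otimes> c))"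
proof
  show "cyl n f \<subseteq> (\<Union>c\<in>C (Suc n). cyl (Suc n) (f \<otimes> c))"
  proof
    fix p assume "p \<in> cyl n f"
    then have "p \<in> stage n" "coord n p = f"
      by (auto simp: cyl_eq)
    then show "p \<in> (\<Union>c\<in>C (Suc n). cyl (Suc n) (f \<otimes> c))"
      using coord_Suc[of p n] stage_Suc[of p n] unfolding cyl_eq by blast
  qed
  show "(\<Union>c\<in>C (Suc n). cyl (Suc n) (f \<otimes> c)) \<subseteq> cyl n f"
  proof safe
    fix c p assume c: "c \<in> C (Suc n)" and "p \<in> cyl (Suc n) (f \<otimes> c)"
    moreover obtain q where "q \<in> stage n" "coord n q = f" "coord (Suc n) q = f \<otimes> c"
      using ex_coord_Suc[OF assms c] .
    ultimately show "p \<in> cyl n f"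
      using stage_back_Suc[of q n p] by (auto simp: cyl_eq)
  qed
qed

lemma cyl_empty: "f \<notin> F n \<Longrightarrow> cyl n f = {}"
  using coord_F by (auto simp: cyl_eq)

text \<open>One common point puts the whole finer cylinder into the coarser one, by
  \<open>cyl_refine\<close>. Cylinders thus behave like the balls of an ultrametric space.\<close>

lemma cyl_Int:
  assumes "n \<le> m"
  shows "cyl n f \<inter> cyl m f' = {} \<or> cyl m f' \<subseteq> cyl n f"
  using cyl_refine[OF _ assms] by (force simp: cyl_eq)

lemma space_eq_cyl: "cf_space G C F = (\<Union>n. \<Union>f\<in>F n. cyl n f)"
  unfolding space_eq cyl_eq using coord_F by blast

section \<open>Partial translations in coordinates\<close>

lemma domain_eq: "cf_domain G C F g = {p. \<exists>n. p \<in> stage n \<and> g \<otimes> coord n p \<in> F n}"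
proof -
  have "incl n ` {x \<in> level n. g \<otimes> x n \<in> F n} = {p \<in> stage n. g \<otimes> coord n p \<in> F n}" for n
    unfolding stage_def using coord_incl by auto
  then show ?thesis
    unfolding cf_domain_def by blast
qed

text \<open>Coordinates grow on the right while \<open>g\<close> acts on the left, so the inclusion
  of \<open>F n <#> C (Suc n)\<close> in \<open>F (Suc n)\<close> carries the membership
  upwards.\<close>

lemma domain_Suc:
  assumes "g \<in> carrier G" "p \<in> stage n" "g \<otimes> coord n p \<in> F n"
  shows "g \<otimes> coord (Suc n) p \<in> F (Suc n)"
proof -
  obtain c where "c \<in> C (Suc n)" "coord (Suc n) p = coord n p \<otimes> c"
    using coord_Suc[OF assms(2)] .
  then show ?thesis
    using assms F_C_mult C_carrier coord_carrier by (metis m_assoc)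
qed

lemma domain_mono:
  assumes "g \<in> carrier G" "p \<in> stage n" "g \<otimes> coord n p \<in> F n" "n \<le> m"
  shows "g \<otimes> coord m p \<in> F m"
  using assms(4)
proof (induction m rule: dec_induct)
  case (step m)
  then show ?case
    using domain_Suc[of g p m] assms(1) stage_mono[OF assms(2), of m] by auto
qed (use assms in auto)

abbreviation "act \<equiv> cf_action G C F"

lemma shift_level:
  assumes "g \<in> carrier G" "x \<in> level n" "g \<otimes> x n \<in> F n"
  defines "y \<equiv> x(n := g \<otimes> x n)"
  shows "y \<in> level n" "n \<le> m \<Longrightarrow> coord m (incl n y) = g \<otimes> coord m (incl n x)"
proof -
  show y: "y \<in> level n"
    using assms by (auto simp: level_iff extensional_def)
  show "coord m (incl n y) = g \<otimes> coord m (incl n x)" if "n \<le> m"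
    using that
  proof (induction m rule: dec_induct)
    case base
    then show ?case
      unfolding coord_incl[OF y] coord_incl[OF assms(2)] by (simp add: y_def)
  next
    case (step m)
    have "coord m (incl n x) \<in> carrier G" "x (Suc m) \<in> carrier G" "x (Suc m) = y (Suc m)"
      using step assms(2) coord_carrier stage_mono incl_stage level_C C_carrier
      by (blast, blast, auto simp: y_def)
    then show ?case
      using step coord_Suc_incl[OF y, of m] coord_Suc_incl[OF assms(2), of m] assms(1)
      by (simp add: m_assoc)
  qed
qed

text \<open>The definite description in \<open>cf_action\<close> is resolved here: representatives
  of \<open>p\<close> at levels \<open>n\<close> and \<open>k\<close> lead to points with equal
  coordinates from \<open>max n k\<close> on, hence to the same point. Afterwards the action is left
  multiplication of all late coordinates.\<close>

lemma act:
  assumes g: "g \<in> carrier G" and p: "p \<in> stage n" and gp: "g \<otimes> coord n p \<in> F n"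
  shows "act g p \<in> stage n" and "n \<le> m \<Longrightarrow> coord m (act g p) = g \<otimes> coord m p"
proof -
  obtain x where x: "x \<in> level n" "p = incl n x" "coord n p = x n"
    using p stageE by blast
  let ?q = "incl n (x(n := g \<otimes> x n))"
  have gx: "g \<otimes> x n \<in> F n"
    using gp x by simp
  have "act g p = ?q"
    unfolding cf_action_def
  proof (rule the_equality)
    show "\<exists>n. \<exists>x\<in>level n. g \<otimes> x n \<in> F n \<and> p = incl n x \<and> ?q = incl n (x(n := g \<otimes> x n))"
      using x gx by blast
    fix q
    assume "\<exists>n. \<exists>x\<in>level n. g \<otimes> x n \<in> F n \<and> p = incl n x \<and> q = incl n (x(n := g \<otimes> x n))"
    then obtain k y where y: "y \<in> level k" "g \<otimes> y k \<in> F k" "p = incl k y"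
        "q = incl k (y(k := g \<otimes> y k))"
      by blast
    show "q = ?q"
    proof (rule point_eqI[of _ "max n k"])
      show "q \<in> stage (max n k)"
        using incl_stage[OF shift_level(1)[OF g y(1,2)]] y(4) stage_mono by simp
      show "?q \<in> stage (max n k)"
        using incl_stage[OF shift_level(1)[OF g x(1) gx]] stage_mono by simp
      show "coord m q = coord m ?q" if "max n k \<le> m" for m
        using shift_level(2)[OF g y(1,2), of m] shift_level(2)[OF g x(1) gx, of m] x(2) y(3,4) that
        by simp
    qed
  qed
  then show "act g p \<in> stage n" "n \<le> m \<Longrightarrow> coord m (act g p) = g \<otimes> coord m p"
    using shift_level[OF g x(1) gx] x incl_stage by auto
qed


section \<open>The action, topology and cylinders\<close>

abbreviation "full_domain \<equiv> cf_full_domain G C F"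

section \<open>The group law on the full domain\<close>

lemma point_eqI_eventually:
  assumes "\<forall>\<^sub>F m in sequentially. p \<in> stage m \<and> q \<in> stage m \<and> coord m p = coord m q"
  shows "p = q"
proof -
  obtain n where "\<And>m. n \<le> m \<Longrightarrow> p \<in> stage m \<and> q \<in> stage m \<and> coord m p = coord m q"
    using assms unfolding eventually_sequentially by blast
  then show ?thesis
    using point_eqI[of p n q] by blast
qed

text \<open>By \<open>domain_mono\<close> the existence of one good level is the same as all late
  levels being good. Finitely many such conditions can be combined, so the group laws reduce to
  associativity at a late level.\<close>

lemma domain_iff_eventually:
  assumes "g \<in> carrier G"
  shows "p \<in> cf_domain G C F g \<longleftrightarrow> (\<forall>\<^sub>F m in sequentially. p \<in> stage m \<and> g \<otimes> coord m p \<in> F m)"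
  using domain_mono[OF assms, of p] stage_mono[of p]
  unfolding domain_eq eventually_sequentially by blast

lemma eventually_act:
  assumes "g \<in> carrier G" "p \<in> cf_domain G C F g"
  shows "\<forall>\<^sub>F m in sequentially. act g p \<in> stage m \<and> coord m (act g p) = g \<otimes> coord m p
           \<and> p \<in> stage m \<and> g \<otimes> coord m p \<in> F m"
  using assms(2)[unfolded domain_iff_eventually[OF assms(1)]]
proof eventually_elim
  case (elim m)
  then show ?case
    using act(1)[OF assms(1), of p m] act(2)[OF assms(1), of p m m] by blast
qed

lemma full_domainD: "p \<in> full_domain \<Longrightarrow> g \<in> carrier G \<Longrightarrow> p \<in> cf_domain G C F g"
  by (auto simp: cf_full_domain_def)

lemma act_full_domain:
  assumes p: "p \<in> full_domain" and g: "g \<in> carrier G"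
  shows "act g p \<in> full_domain"
  unfolding cf_full_domain_def
proof
  fix h assume h: "h \<in> carrier G"
  have "\<forall>\<^sub>F m in sequentially. act g p \<in> stage m \<and> h \<otimes> coord m (act g p) \<in> F m"
    using eventually_act[OF g full_domainD[OF p g]]
      eventually_act[OF m_closed[OF h g] full_domainD[OF p m_closed[OF h g]]]
  proof eventually_elim
    case (elim m)
    then show ?case
      using coord_carrier[of p m] g h by (simp add: m_assoc)
  qed
  then show "act g p \<in> cf_domain G C F h"
    using domain_iff_eventually[OF h] by blast
qed

lemma act_mult:
  assumes p: "p \<in> full_domain" and g: "g \<in> carrier G" and h: "h \<in> carrier G"
  shows "act h (act g p) = act (h \<otimes> g) p"
proof (rule point_eqI_eventually)
  show "\<forall>\<^sub>F m in sequentially. act h (act g p) \<in> stage m \<and> act (h \<otimes> g) p \<in> stage m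
          \<and> coord m (act h (act g p)) = coord m (act (h \<otimes> g) p)"
    using eventually_act[OF g full_domainD[OF p g]]
      eventually_act[OF m_closed[OF h g] full_domainD[OF p m_closed[OF h g]]]
      eventually_act[OF h full_domainD[OF act_full_domain[OF p g] h]]
  proof eventually_elim
    case (elim m)
    then show ?case
      using coord_carrier[of p m] g h by (simp add: m_assoc)
  qed
qed

lemma act_one:
  assumes p: "p \<in> full_domain"
  shows "act \<one> p = p"
proof (rule point_eqI_eventually)
  show "\<forall>\<^sub>F m in sequentially. act \<one> p \<in> stage m \<and> p \<in> stage m \<and> coord m (act \<one> p) = coord m p"
    using eventually_act[OF one_closed full_domainD[OF p one_closed]]
  proof eventually_elim
    case (elim m)
    then show ?case
      using coord_carrier[of p m] by simp
  qed
qed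

section \<open>Cylinders as a countable base of the topology\<close>

lemma coord_incl_cong:
  assumes x: "x \<in> level m" and y: "y \<in> level m" and "m \<le> N" and "\<And>i. m \<le> i \<Longrightarrow> i \<le> N \<Longrightarrow> x i = y i"
  shows "coord N (incl m x) = coord N (incl m y)"
  using assms(3,4)
proof (induction N rule: dec_induct)
  case base
  then show ?case
    using x y by (simp add: coord_incl)
next
  case (step N)
  then show ?case
    using coord_Suc_incl[OF x, of N] coord_Suc_incl[OF y, of N] by simp
qed

lemma openin_cyl: "openin (cf_topology G C F) (cyl n f)"
  unfolding openin_cf_topology cf_open_def
proof (intro conjI allI)
  show "cyl n f \<subseteq> cf_space G C F"
    by (auto simp: space_eq cyl_eq)
  fix m
  show "openin (cf_level_topology C F m) {x \<in> level m. incl m x \<in> cyl n f}"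
    unfolding cf_level_topology_def openin_product_topology_alt
  proof
    fix x assume "x \<in> {x \<in> level m. incl m x \<in> cyl n f}"
    then have x: "x \<in> level m" and xn: "incl m x \<in> stage n" "coord n (incl m x) = f"
      by (auto simp: cyl_eq)
    let ?S = "\<lambda>i. if i = m then F m else C i"
    \<comment> \<open>Pinning the entries up to \<open>max m n\<close> restricts only finitely many
      factors, and these entries decide whether a point of level \<open>m\<close> lies in
      \<open>cyl n f\<close>.\<close>
    define U where "U = (\<lambda>i. if i \<le> max m n then {x i} else ?S i)"
    have xi: "x i \<in> ?S i" if "m \<le> i" for i
      using x that by (auto simp: level_iff le_less)
    have "incl m y \<in> cyl n f" if y: "y \<in> Pi\<^sub>E {m..} U" for y
    proof -
      have yl: "y \<in> level m"
        using y xi unfolding cf_level_def PiE_iff U_def by (fastforce split: if_splits)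
      have "coord (max m n) (incl m x) = coord (max m n) (incl m y)"
        using y by (intro coord_incl_cong x yl) (force simp: PiE_iff U_def)+
      then show ?thesis
        using stage_back[OF xn(1), of "max m n" "incl m y"] stage_mono[OF incl_stage[OF yl], of "max m n"] xn
        by (auto simp: cyl_eq)
    qed
    moreover have "y \<in> level m" if y: "y \<in> Pi\<^sub>E {m..} U" for y
      using y xi unfolding cf_level_def PiE_iff U_def by (fastforce split: if_splits)
    moreover have "finite {i \<in> {m..}. U i \<noteq> topspace (discrete_topology (?S i))}"
      by (rule finite_subset[of _ "{..max m n}"]) (auto simp: U_def)
    moreover have "openin (discrete_topology (?S i)) (U i)" if "m \<le> i" for i
      using xi[OF that] by (auto simp: U_def)
    moreover have "x \<in> Pi\<^sub>E {m..} U"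
      using x xi by (auto simp: U_def PiE_iff level_iff)
    ultimately show "\<exists>U. finite {i \<in> {m..}. U i \<noteq> topspace (discrete_topology (?S i))} \<and>
        (\<forall>i\<in>{m..}. openin (discrete_topology (?S i)) (U i)) \<and> x \<in> Pi\<^sub>E {m..} U \<and>
        Pi\<^sub>E {m..} U \<subseteq> {x \<in> level m. incl m x \<in> cyl n f}"
      by (intro exI[of _ U]) (auto simp del: openin_discrete_topology topspace_discrete_topology)
  qed
qed

lemma open_contains_cyl:
  assumes U: "openin (cf_topology G C F) U" and p: "p \<in> U"
  obtains N where "k \<le> N" "p \<in> stage N" "cyl N (coord N p) \<subseteq> U"
proof -
  have "p \<in> cf_space G C F"
    using U p by (auto simp: openin_cf_topology cf_open_def)
  then obtain n x where x: "x \<in> level n" "p = incl n x"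
    unfolding space_eq by (auto elim: stageE)
  let ?S = "\<lambda>i. if i = n then F n else C i"
  have "openin (product_topology (\<lambda>i. discrete_topology (?S i)) {n..}) {x \<in> level n. incl n x \<in> U}"
    using U by (auto simp: openin_cf_topology cf_open_def cf_level_topology_def)
  then obtain V where V: "finite {i \<in> {n..}. V i \<noteq> topspace (discrete_topology (?S i))}"
      "x \<in> Pi\<^sub>E {n..} V" "Pi\<^sub>E {n..} V \<subseteq> {x \<in> level n. incl n x \<in> U}"
    unfolding openin_product_topology_alt using x p by blast
  \<comment> \<open>Only finitely many factors are constrained by \<open>V\<close>; beyond
    \<open>M\<close> every entry is allowed. Hence fixing the coordinate at a level past both
    \<open>n\<close> and \<open>M\<close> already puts a point into the neighbourhood.\<close>
  then obtain M where M: "\<And>i. i \<in> {i \<in> {n..}. V i \<noteq> topspace (discrete_topology (?S i))} \<Longrightarrow> i \<le> M"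
    unfolding finite_nat_set_iff_bounded_le by blast
  define N where "N = max k (max n M)"
  have "q \<in> U" if q: "q \<in> cyl N (coord N p)" for q
  proof -
    have pn: "p \<in> stage n"
      using x incl_stage by blast
    have *: "q \<in> stage n \<and> coord i q = coord i p" if "n \<le> i" "i \<le> N" for i
      using stage_back[OF stage_mono[OF pn, of i], of N q] stage_back[OF pn, of N q] q that
      by (auto simp: cyl_eq N_def)
    then obtain y where y: "y \<in> level n" "q = incl n y"
      by (metis N_def le_max_iff_disj max.cobounded1 stageE)
    have "y i = x i" if "n \<le> i" "i \<le> N" for i
    proof (cases "i = n")
      case True
      then show ?thesis
        using *[of n] x y that by (simp add: coord_incl)
    next
      case False
      then obtain j where j: "i = Suc j" "n \<le> j"
        using \<open>n \<le> i\<close> by (metis le_Suc_eq not0_implies_Suc le_zero_eq)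
      then have "coord j p \<otimes> y i = coord j p \<otimes> x i"
        using *[of i] *[of j] coord_Suc_incl[OF x(1) j(2)] coord_Suc_incl[OF y(1) j(2)] x y that
        by simp
      moreover have "coord j p \<in> carrier G"
        using stage_mono[OF pn j(2)] coord_carrier by blast
      ultimately show ?thesis
        using j level_C[OF x(1) j(2)] level_C[OF y(1) j(2)] C_carrier
        by (metis Units_eq Units_l_cancel)
    qed
    then have "y i \<in> V i" if "n \<le> i" for i
    proof (cases "i \<le> N")
      case True
      then show ?thesis
        using V(2) that \<open>\<And>i. n \<le> i \<Longrightarrow> i \<le> N \<Longrightarrow> y i = x i\<close> by (auto simp: PiE_iff)
    next
      case False
      then have "V i = topspace (discrete_topology (?S i))"
        using M[of i] that unfolding N_def by fastforce
      then show ?thesis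
        using y(1) that by (auto simp: level_iff le_less)
    qed
    then have "y \<in> Pi\<^sub>E {n..} V"
      using y(1) by (auto simp: PiE_iff level_iff)
    then show ?thesis
      using V(3) y by blast
  qed
  moreover have "p \<in> stage N"
    using stage_mono[OF incl_stage[OF x(1)], of N] x by (simp add: N_def)
  ultimately show thesis
    by (intro that[of N]) (auto simp: N_def)
qed

text \<open>The empty set makes the family closed under intersection. The lower bound
  \<open>k\<close> does not change the generated \<sigma>-algebra, and it spares inductions over
  generators the cylinders coarser than a given one.\<close>

definition cylinders :: "nat \<Rightarrow> 'a cf_point set set" where
  "cylinders k = insert {} {cyl m f | m f. k \<le> m \<and> f \<in> F m}"

lemma cylinders_subset: "cylinders k \<subseteq> Pow (cf_space G C F)"
  by (auto simp: cylinders_def space_eq cyl_eq)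

lemma countable_cylinders: "countable (cylinders k)"
proof -
  have "countable (SIGMA m:UNIV. F m)"
    using F_finite by (intro countable_SIGMA) (auto intro: countable_finite)
  moreover have "cylinders k \<subseteq> insert {} ((\<lambda>(m, f). cyl m f) ` (SIGMA m:UNIV. F m))"
    by (force simp: cylinders_def)
  ultimately show ?thesis
    by (meson countable_image countable_insert countable_subset)
qed

lemma Int_stable_cylinders: "Int_stable (cylinders k)"
proof (rule Int_stableI)
  have *: "cyl n f \<inter> cyl m f' \<in> cylinders k" if "n \<le> m" "k \<le> m" "f' \<in> F m" for n m f f'
    using cyl_Int[OF that(1), of f f'] that by (auto simp: cylinders_def Int_absorb1)
  fix A B assume "A \<in> cylinders k" "B \<in> cylinders k"
  moreover have "cyl n f \<inter> cyl m f' \<in> cylinders k"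
    if "k \<le> n" "k \<le> m" "f \<in> F n" "f' \<in> F m" for n m f f'
    using *[of n m f' f] *[of m n f f'] that by (metis Int_commute linear)
  moreover have "{} \<in> cylinders k" "D = {} \<or> (\<exists>m f. D = cyl m f \<and> k \<le> m \<and> f \<in> F m)"
    if "D \<in> cylinders k" for D
    using that by (auto simp: cylinders_def)
  ultimately show "A \<inter> B \<in> cylinders k"
    by (metis Int_empty_left Int_empty_right)
qed

text \<open>An open set is the union of the cylinders of level at least \<open>k\<close> inside it,
  and there are only countably many cylinders.\<close>

lemma sigma_sets_cylinders:
  "sigma_sets (cf_space G C F) {U. openin (cf_topology G C F) U} = sigma_sets (cf_space G C F) (cylinders k)"
proof
  show "sigma_sets (cf_space G C F) {U. openin (cf_topology G C F) U} \<subseteq> sigma_sets (cf_space G C F) (cylinders k)"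
  proof (rule sigma_sets_mono, safe)
    fix U assume U: "openin (cf_topology G C F) U"
    let ?\<D> = "{D \<in> cylinders k. D \<subseteq> U}"
    have "U \<subseteq> \<Union>?\<D>"
    proof
      fix p assume "p \<in> U"
      then obtain N where "k \<le> N" "p \<in> stage N" "cyl N (coord N p) \<subseteq> U"
        using open_contains_cyl[OF U] by blast
      then have "cyl N (coord N p) \<in> ?\<D>" "p \<in> cyl N (coord N p)"
        using coord_F[of p N] unfolding cylinders_def by (blast, simp add: cyl_eq)
      then show "p \<in> \<Union>?\<D>"
        by blast
    qed
    then have "U = \<Union>?\<D>"
      by blast
    moreover have "\<Union>?\<D> \<in> sigma_sets (cf_space G C F) (cylinders k)"
      using countable_cylinders[of k]
      by (intro sigma_sets_UNION) (auto intro: countable_subset)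
    ultimately show "U \<in> sigma_sets (cf_space G C F) (cylinders k)"
      by simp
  qed
  show "sigma_sets (cf_space G C F) (cylinders k) \<subseteq> sigma_sets (cf_space G C F) {U. openin (cf_topology G C F) U}"
    by (rule sigma_sets_mono) (auto simp: cylinders_def openin_cyl)
qed

text \<open>From one level to the next, \<open>coord m p\<close> and
  \<open>g \<otimes> coord m p\<close> gain the same right factor, so both masses are multiplied by
  the same weight of \<kappa>. The constant ratio is the Radon-Nikodym derivative of the translation
  on the cylinder, written here without division.\<close>

lemma \<nu>_ratio:
  assumes "g \<in> carrier G" "p \<in> stage n" "g \<otimes> coord n p \<in> F n" "n \<le> m"
  shows "\<nu> m (coord m p) * \<nu> n (g \<otimes> coord n p) = \<nu> m (g \<otimes> coord m p) * \<nu> n (coord n p)"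
  using assms(4)
proof (induction m rule: dec_induct)
  case (step m)
  have p: "p \<in> stage m"
    using stage_mono assms step by blast
  obtain c where c: "c \<in> C (Suc m)" "coord (Suc m) p = coord m p \<otimes> c"
    using coord_Suc[OF p] .
  have "g \<otimes> coord (Suc m) p = g \<otimes> coord m p \<otimes> c"
    using c C_carrier coord_carrier[OF p] assms by (simp add: m_assoc)
  then have "\<nu> (Suc m) (g \<otimes> coord (Suc m) p) = \<nu> m (g \<otimes> coord m p) * pmf (\<kappa> (Suc m)) c"
    using \<nu>_Suc[OF domain_mono[OF assms(1-3)] c(1)] step by simp
  moreover have "\<nu> (Suc m) (coord (Suc m) p) = \<nu> m (coord m p) * pmf (\<kappa> (Suc m)) c"
    using \<nu>_Suc[OF coord_F[OF p] c(1)] c by simp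
  ultimately show ?case
    using step.IH by (simp add: algebra_simps)
qed simp

end


section \<open>Rescaling and density of cylinders\<close>

text \<open>The sets that can be approximated in measure by members of \<open>\<A>\<close> contain
  \<open>\<A>\<close> and are closed under complements and countable unions.\<close>

lemma (in finite_measure) algebra_approximation:
  assumes alg: "algebra (space M) \<A>" and gen: "sets M = sigma_sets (space M) \<A>"
    and E: "E \<in> sets M" and "0 < \<epsilon>"
  shows "\<exists>D\<in>\<A>. measure M ((E - D) \<union> (D - E)) < \<epsilon>"
proof -
  interpret algebra "space M" \<A> by fact
  have sets: "D \<in> sets M" if "D \<in> \<A>" for D
    using that gen by auto
  have "E \<in> sigma_sets (space M) \<A>"
    using E gen by simp
  then show ?thesis
    using \<open>0 < \<epsilon>\<close>
  proof (induction arbitrary: \<epsilon> rule: sigma_sets.induct)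
    case (Basic a)
    then show ?case by (intro bexI[of _ a]) auto
  next
    case Empty
    then show ?case by (intro bexI[of _ "{}"]) auto
  next
    case (Compl a)
    then obtain D where D: "D \<in> \<A>" "measure M ((a - D) \<union> (D - a)) < \<epsilon>"
      by blast
    have "(space M - a - (space M - D)) \<union> (space M - D - (space M - a)) = (a - D) \<union> (D - a)"
      using sets.sets_into_space sets[OF D(1)] Compl(1) gen by blast
    then show ?case
      using D by (intro bexI[of _ "space M - D"]) auto
  next
    case (Union a)
    have a: "a i \<in> sets M" for i
      using Union gen by simp
    \<comment> \<open>Half of the error is spent on cutting the union off at \<open>N\<close>, the
      other half is divided among the \<open>N\<close> remaining sets; the denominator uses
      \<open>N + 1\<close> so that it is positive also for \<open>N = 0\<close>.\<close>
    let ?B = "\<lambda>N. \<Union>i<N. a i"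
    have "(\<lambda>N. measure M (?B N)) \<longlonglongrightarrow> measure M (\<Union>N. ?B N)"
      using a by (intro finite_Lim_measure_incseq) (auto simp: incseq_def intro: less_le_trans)
    moreover have "(\<Union>N. ?B N) = \<Union>(range a)"
      by auto
    ultimately have "\<forall>\<^sub>F N in sequentially. measure M (\<Union>(range a)) - \<epsilon> / 2 < measure M (?B N)"
      using Union.prems by (intro order_tendstoD) auto
    then obtain N where N: "measure M (\<Union>(range a)) - \<epsilon> / 2 < measure M (?B N)"
      by (auto simp: eventually_sequentially)
    have "\<exists>D\<in>\<A>. measure M ((a i - D) \<union> (D - a i)) < \<epsilon> / (2 * (real N + 1))" for i
      using Union by simp
    then obtain D where D: "\<And>i. D i \<in> \<A>"
        "\<And>i. measure M ((a i - D i) \<union> (D i - a i)) < \<epsilon> / (2 * (real N + 1))"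
      by metis
    note Ds = sets[OF D(1)]
    let ?D = "\<Union>i<N. D i"
    let ?d = "\<lambda>i. (a i - D i) \<union> (D i - a i)"
    have "measure M ((\<Union>(range a) - ?D) \<union> (?D - \<Union>(range a)))
        \<le> measure M ((\<Union>(range a) - ?B N) \<union> (\<Union>i<N. ?d i))"
      using a Ds by (intro finite_measure_mono) (auto intro!: sets.Un sets.Diff sets.countable_UN)
    also have "\<dots> \<le> measure M (\<Union>(range a) - ?B N) + measure M (\<Union>i<N. ?d i)"
      using a Ds by (intro measure_Un_le) (auto intro!: sets.Un sets.Diff sets.countable_UN)
    also have "measure M (\<Union>(range a) - ?B N) = measure M (\<Union>(range a)) - measure M (?B N)"
      using a by (intro finite_measure_Diff) auto
    also have "measure M (\<Union>i<N. ?d i) \<le> (\<Sum>i<N. measure M (?d i))"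
      using a Ds by (intro finite_measure_subadditive_finite) auto
    also have "\<dots> \<le> (\<Sum>i<N. \<epsilon> / (2 * (real N + 1)))"
      using D(2) by (intro sum_mono) (auto intro: less_imp_le)
    also have "\<dots> \<le> \<epsilon> / 2"
      using Union.prems by (simp add: field_simps)
    finally have "measure M ((\<Union>(range a) - ?D) \<union> (?D - \<Union>(range a))) < \<epsilon>"
      using N by linarith
    moreover have "?D \<in> \<A>"
      using D(1) by auto
    ultimately show ?case
      by blast
  qed
qed

section \<open>The measure of cylinders and its behaviour under the action\<close>

locale cf_measured = cf_parameters +
  fixes \<mu> :: "'a cf_point measure"
  assumes \<mu>: "cf_measure G C F \<nu> \<mu>" and countable_carrier: "countable (carrier G)"
begin

lemma space_\<mu>: "space \<mu> = cf_space G C F"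
  using \<mu> by (simp add: cf_measure_def)

lemma sets_\<mu>: "sets \<mu> = sigma_sets (cf_space G C F) (cylinders k)"
  using \<mu> sigma_sets_cylinders[of k] by (simp add: cf_measure_def)

lemma cyl_sets [measurable]: "cyl n f \<in> sets \<mu>"
proof (cases "f \<in> F n")
  case True
  then have "cyl n f \<in> cylinders 0"
    by (auto simp: cylinders_def)
  then show ?thesis
    using sets_\<mu>[of 0] by auto
qed (simp add: cyl_empty)

lemma emeasure_cyl: "f \<in> F n \<Longrightarrow> emeasure \<mu> (cyl n f) = ennreal (\<nu> n f)"
  using \<mu> by (simp add: cf_measure_def)

lemma measure_cyl: "f \<in> F n \<Longrightarrow> measure \<mu> (cyl n f) = \<nu> n f"
  using \<nu>_support[of f n] by (simp add: measure_def emeasure_cyl)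

lemma fmeasurable_cyl: "cyl n f \<in> fmeasurable \<mu>"
  using emeasure_cyl[of f n] cyl_empty[of f n]
  by (intro fmeasurableI) (cases "f \<in> F n"; auto)+

lemma fmeasurable_cyl_Int: "B \<in> sets \<mu> \<Longrightarrow> cyl n f \<inter> B \<in> fmeasurable \<mu>"
  by (rule fmeasurable_Int_fmeasurable[OF fmeasurable_cyl])

lemma domain_eq_cyl: "cf_domain G C F g = (\<Union>n. \<Union>f\<in>{f \<in> F n. g \<otimes> f \<in> F n}. cyl n f)"
  unfolding domain_eq cyl_eq using coord_F by blast

lemma full_domain_sets [measurable]: "full_domain \<in> sets \<mu>"
proof -
  have "cf_domain G C F g \<in> sets \<mu>" for g
    unfolding domain_eq_cyl using F_finite
    by (intro sets.countable_UN' sets.finite_UN) auto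
  then show ?thesis
    unfolding cf_full_domain_def using countable_carrier one_closed
    by (intro sets.countable_INT') auto
qed

lemma act_cyl:
  assumes g: "g \<in> carrier G" and p: "p \<in> cyl n f" and gf: "g \<otimes> f \<in> F n"
  shows "act g p \<in> cyl n (g \<otimes> f)" "n \<le> m \<Longrightarrow> coord m (act g p) = g \<otimes> coord m p"
    "act (inv g) (act g p) = p"
proof -
  have p': "p \<in> stage n" "g \<otimes> coord n p \<in> F n" "coord n p = f"
    using p gf by (auto simp: cyl_eq)
  note * = act[OF g p'(1,2)]
  show "act g p \<in> cyl n (g \<otimes> f)" "n \<le> m \<Longrightarrow> coord m (act g p) = g \<otimes> coord m p"
    using * p' by (auto simp: cyl_eq)
  have inv: "inv g \<otimes> (g \<otimes> coord m p) = coord m p" if "n \<le> m" for m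
    using g coord_carrier[OF stage_mono[OF p'(1) that]] by (simp add: m_assoc[symmetric])
  then have "inv g \<otimes> coord n (act g p) \<in> F n"
    using *(2)[of n] p' coord_F by auto
  note ** = act[OF inv_closed[OF g] *(1) this]
  show "act (inv g) (act g p) = p"
    using ** * inv p' by (intro point_eqI[of _ n]) auto
qed

text \<open>By \<open>\<nu>_ratio\<close> the translation scales the masses of all cylinders inside
  \<open>cyl n f\<close> by the same factor. Cylinders of level at least \<open>n\<close> form an
  intersection-stable generator, so the scaling extends to all measurable sets. Measurability of the
  preimage is established in the same induction.\<close>

lemma act_scaling:
  assumes g: "g \<in> carrier G" and f: "f \<in> F n" and gf: "g \<otimes> f \<in> F n" and B: "B \<in> sets \<mu>"
  shows "{p \<in> cyl n f. act g p \<in> B} \<in> sets \<mu> \<and>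
    measure \<mu> {p \<in> cyl n f. act g p \<in> B} * \<nu> n (g \<otimes> f) = measure \<mu> (cyl n (g \<otimes> f) \<inter> B) * \<nu> n f"
proof -
  let ?P = "\<lambda>B. {p \<in> cyl n f. act g p \<in> B}"
  note a = act_cyl[OF g _ gf]
  note \<mu>gen = sets_\<mu>[of n]
  have B': "B \<in> sigma_sets (cf_space G C F) (cylinders n)"
    using B \<mu>gen by simp
  show ?thesis
    using Int_stable_cylinders cylinders_subset B'
  proof (induction rule: sigma_sets_induct_disjoint)
    case (basic A)
    show ?case
    proof (cases "cyl n (g \<otimes> f) \<inter> A = {}")
      case True
      then have "?P A = {}"
        using a(1) by auto
      then show ?thesis
        unfolding \<open>?P A = {}\<close> True by simp
    next
      case False
      with basic obtain m h q where A: "A = cyl m h" "n \<le> m" "h \<in> F m"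
        and q: "q \<in> cyl n (g \<otimes> f)" "q \<in> cyl m h"
        by (auto simp: cylinders_def)
      have gfi: "inv g \<otimes> (g \<otimes> f) = f"
        using g F_carrier[OF f] by (simp add: m_assoc[symmetric])
      note b = act_cyl[OF inv_closed[OF g] q(1), unfolded gfi, OF f]
      \<comment> \<open>\<open>A\<close> meets \<open>cyl n (g \<otimes> f)\<close> in
        \<open>q\<close>, hence lies inside it; its preimage is the whole cylinder of level
        \<open>m\<close> through the point \<open>p\<close> below \<open>q\<close>.\<close>
      define p where "p = act (inv g) q"
      have p: "p \<in> cyl n f" "act g p = q"
        using b g by (auto simp: p_def)
      have pn: "p \<in> stage n" "coord n p = f"
        using p by (auto simp: cyl_eq)
      have hm: "g \<otimes> coord m p = h"
        using a(2)[OF p(1) A(2)] p q by (auto simp: cyl_eq)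
      have "?P A = cyl m (coord m p)"
      proof
        show "?P A \<subseteq> cyl m (coord m p)"
        proof safe
          fix r assume r: "r \<in> cyl n f" "act g r \<in> A"
          then have "r \<in> stage m" "coord m r \<in> carrier G" "coord m p \<in> carrier G"
            using stage_mono[OF _ A(2)] pn(1) coord_carrier by (auto simp: cyl_eq)
          moreover have "g \<otimes> coord m r = g \<otimes> coord m p"
            using a(2)[OF r(1) A(2)] r A hm by (auto simp: cyl_eq)
          ultimately show "r \<in> cyl m (coord m p)"
            using g by (simp add: cyl_eq)
        qed
        show "cyl m (coord m p) \<subseteq> ?P A"
        proof
          fix r assume r: "r \<in> cyl m (coord m p)"
          then have "r \<in> cyl n f"
            using cyl_refine[OF pn(1) A(2)] pn(2) by auto
          moreover from this have "act g r \<in> cyl m h"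
            using a(1)[of r] a(2)[of r m] stage_mono[OF _ A(2), of "act g r"] A r hm by (auto simp: cyl_eq)
          ultimately show "r \<in> ?P A"
            using A by simp
        qed
      qed
      moreover have "cyl n (g \<otimes> f) \<inter> A = A"
        using cyl_Int[OF A(2), of "g \<otimes> f" h] q A by auto
      ultimately show ?thesis
        using \<nu>_ratio[OF g pn(1) _ A(2)] pn gf hm A coord_F[OF stage_mono[OF pn(1) A(2)]]
        by (simp add: measure_cyl)
    qed
  next
    case empty
    then show ?case by simp
  next
    case (compl A)
    have A: "A \<in> sets \<mu>"
      using compl \<mu>gen by simp
    have "act g p \<in> cf_space G C F" if "p \<in> cyl n f" for p
      using a(1)[OF that] by (auto simp: space_eq cyl_eq)
    then have 1: "?P (cf_space G C F - A) = cyl n f - ?P A"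
      by blast
    have 2: "cyl n (g \<otimes> f) \<inter> (cf_space G C F - A) = cyl n (g \<otimes> f) - (cyl n (g \<otimes> f) \<inter> A)"
      by (auto simp: space_eq cyl_eq)
    have 3: "?P A \<in> fmeasurable \<mu>"
      using compl by (intro fmeasurableI2[OF fmeasurable_cyl[of n f]]) auto
    have "measure \<mu> (cyl n f - ?P A) = \<nu> n f - measure \<mu> (?P A)"
      using measure_Diff[of \<mu> "cyl n f" "?P A"] fmeasurable_cyl[of n f] 3
      by (auto simp: measure_cyl[OF f] fmeasurable_def subset_iff)
    moreover have "measure \<mu> (cyl n (g \<otimes> f) - (cyl n (g \<otimes> f) \<inter> A))
        = \<nu> n (g \<otimes> f) - measure \<mu> (cyl n (g \<otimes> f) \<inter> A)"
      using measure_Diff[of \<mu> "cyl n (g \<otimes> f)" "cyl n (g \<otimes> f) \<inter> A"] fmeasurable_cyl[of n "g \<otimes> f"] A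
      by (auto simp: measure_cyl[OF gf] fmeasurable_def)
    moreover have "cyl n f - ?P A \<in> sets \<mu>"
      using compl by auto
    ultimately show ?case
      unfolding 1 2 using compl by (simp add: left_diff_distrib right_diff_distrib mult.commute)
  next
    case (union A)
    have A: "A i \<in> sets \<mu>" for i
      using union \<mu>gen by auto
    have "?P (\<Union>(range A)) = (\<Union>i. ?P (A i))" "cyl n (g \<otimes> f) \<inter> \<Union>(range A) = (\<Union>i. cyl n (g \<otimes> f) \<inter> A i)"
      by auto
    moreover have "(\<lambda>i. measure \<mu> (?P (A i))) sums measure \<mu> (\<Union>i. ?P (A i))"
    proof (rule measure_UNION)
      have "(\<Union>i. ?P (A i)) \<in> fmeasurable \<mu>"
        using union by (intro fmeasurableI2[OF fmeasurable_cyl[of n "f"]] sets.countable_UN) auto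
      then show "emeasure \<mu> (\<Union>i. ?P (A i)) \<noteq> \<infinity>"
        by (simp add: fmeasurable_def less_top)
    qed (use union in \<open>auto simp: disjoint_family_on_def\<close>)
    moreover have "(\<lambda>i. measure \<mu> (cyl n (g \<otimes> f) \<inter> A i)) sums measure \<mu> (\<Union>i. cyl n (g \<otimes> f) \<inter> A i)"
    proof (rule measure_UNION)
      have "(\<Union>i. cyl n (g \<otimes> f) \<inter> A i) \<in> fmeasurable \<mu>"
        using A by (intro fmeasurableI2[OF fmeasurable_cyl[of n "(g \<otimes> f)"]] sets.countable_UN) auto
      then show "emeasure \<mu> (\<Union>i. cyl n (g \<otimes> f) \<inter> A i) \<noteq> \<infinity>"
        by (simp add: fmeasurable_def less_top)
    qed (use union A in \<open>auto simp: disjoint_family_on_def\<close>)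
    ultimately have "(\<lambda>i. measure \<mu> (?P (A i)) * \<nu> n (g \<otimes> f)) sums (measure \<mu> (?P (\<Union>(range A))) * \<nu> n (g \<otimes> f))"
        "(\<lambda>i. measure \<mu> (cyl n (g \<otimes> f) \<inter> A i) * \<nu> n f) sums (measure \<mu> (cyl n (g \<otimes> f) \<inter> \<Union>(range A)) * \<nu> n f)"
      by (simp_all add: sums_mult2)
    moreover have "?P (\<Union>(range A)) \<in> sets \<mu>"
      unfolding \<open>?P (\<Union>(range A)) = (\<Union>i. ?P (A i))\<close> using union by (intro sets.countable_UN) auto
    ultimately show ?case
      using union sums_unique2 by simp
  qed
qed

lemma act_vimage_sets:
  assumes g: "g \<in> carrier G" and B: "B \<in> sets \<mu>"
  shows "{p \<in> full_domain. act g p \<in> B} \<in> sets \<mu>"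
proof -
  have "full_domain \<subseteq> cf_domain G C F g"
    using full_domainD[OF _ g] by blast
  then have "{p \<in> full_domain. act g p \<in> B} =
      (\<Union>n. \<Union>f\<in>{f \<in> F n. g \<otimes> f \<in> F n}. full_domain \<inter> {p \<in> cyl n f. act g p \<in> B})"
    unfolding domain_eq_cyl by blast
  also have "\<dots> \<in> sets \<mu>"
  proof (intro sets.countable_UN image_subsetI sets.finite_UN sets.Int full_domain_sets)
    show "{p \<in> cyl n f. act g p \<in> B} \<in> sets \<mu>" if "f \<in> {f \<in> F n. g \<otimes> f \<in> F n}" for n f
      using act_scaling[OF g _ _ B] that by blast
  qed (use F_finite in auto)
  finally show ?thesis .
qed

text \<open>Cylinders take the role of small balls in a Lebesgue density theorem. As they generate
  the \<sigma>-algebra, approximation in measure suffices: if every cylinder had density at most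
  \<open>1 - \<delta>\<close>, no union of cylinders could approximate \<open>E\<close>.\<close>

lemma density:
  assumes E: "E \<in> sets \<mu>" and pos: "E \<notin> null_sets \<mu>" and \<delta>: "0 < \<delta>" "\<delta> < 1"
  obtains n f where "f \<in> F n" "(1 - \<delta>) * \<nu> n f < measure \<mu> (cyl n f \<inter> E)"
proof (rule ccontr)
  assume no: "\<not> thesis"
  have le: "measure \<mu> (cyl n f \<inter> E) \<le> (1 - \<delta>) * \<nu> n f" if "f \<in> F n" for n f
    using no \<open>\<And>n f. f \<in> F n \<Longrightarrow> (1 - \<delta>) * \<nu> n f < measure \<mu> (cyl n f \<inter> E) \<Longrightarrow> thesis\<close>[OF that]
    by force
  \<comment> \<open>Countably many cylinders cover the space, so one of them meets \<open>E\<close>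
    in positive measure. Inside it the measure is finite, as \<open>algebra_approximation\<close>
    requires.\<close>
  have "\<exists>n f. f \<in> F n \<and> cyl n f \<inter> E \<notin> null_sets \<mu>"
  proof (rule ccontr)
    assume "\<nexists>n f. f \<in> F n \<and> cyl n f \<inter> E \<notin> null_sets \<mu>"
    then have "(\<Union>n. \<Union>f\<in>F n. cyl n f \<inter> E) \<in> null_sets \<mu>"
      using F_finite by (intro null_sets_UN null_sets.finite_UN) auto
    moreover have "(\<Union>n. \<Union>f\<in>F n. cyl n f \<inter> E) = E"
      using sets.sets_into_space[OF E] unfolding space_\<mu> space_eq_cyl by auto
    ultimately show False
      using pos by simp
  qed
  then obtain k h where h: "h \<in> F k" "cyl k h \<inter> E \<notin> null_sets \<mu>"
    by blast
  define K where "K = cyl k h"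
  define e where "e = measure \<mu> (K \<inter> E)"
  have KE: "K \<inter> E \<in> fmeasurable \<mu>"
    using fmeasurable_cyl_Int[OF E] by (simp add: K_def)
  have "e \<noteq> 0"
    using h KE fmeasurableD[OF KE] by (auto simp: e_def K_def null_sets_def emeasure_eq_measure2)
  then have e: "0 < e"
    by (simp add: e_def less_le)
  let ?M = "restrict_space \<mu> K"
  \<comment> \<open>\<open>D\<close> is a union of cylinders of level \<open>m\<close>. Such sets form an algebra generating the \<open>\<sigma>\<close>-algebra on \<open>K\<close>,
    so they approximate \<open>K \<inter> E\<close>; cylinders with density at most \<open>1 - \<delta>\<close> would contradict this.\<close>
  define det where "det m D \<longleftrightarrow> (\<forall>p\<in>K. \<forall>q\<in>K. coord m p = coord m q \<longrightarrow> (p \<in> D \<longleftrightarrow> q \<in> D))" for m D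
  let ?\<A> = "{D. D \<subseteq> K \<and> (\<exists>m\<ge>k. det m D)}"
  have K_sets: "K \<in> sets \<mu>"
    by (simp add: K_def)
  have space_M: "space ?M = K"
    using sets.sets_into_space[OF K_sets] by (auto simp: space_restrict_space)
  interpret M: finite_measure ?M
    by (rule finite_measureI)
      (use fmeasurable_cyl[of k h] K_sets in \<open>simp add: space_M emeasure_restrict_space K_def fmeasurable_def\<close>)
  \<comment> \<open>A coordinate determines the coordinates at the lower levels down to
    \<open>k\<close>. So \<open>det\<close> passes to higher levels, and two sets of the algebra can
    be compared at a common level.\<close>
  have coord_down: "coord n p = coord n q" if "p \<in> K" "q \<in> K" "k \<le> n" "n \<le> m" "coord m p = coord m q" for p q n m
    using stage_back[of p n m q] that stage_mono[of p k] stage_mono[of q k] by (auto simp: K_def cyl_eq)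
  have cyl_sub: "cyl m (coord m p) \<subseteq> D"
    if "D \<subseteq> K" "k \<le> m" "det m D" "p \<in> D" for D m p
  proof
    fix q assume q: "q \<in> cyl m (coord m p)"
    have "p \<in> K"
      using that by blast
    then have "p \<in> stage k" "coord k p = h"
      by (auto simp: K_def cyl_eq)
    then have "q \<in> K"
      using cyl_refine[OF _ that(2)] q unfolding K_def by blast
    moreover have "coord m p = coord m q"
      using q by (simp add: cyl_eq)
    ultimately show "q \<in> D"
      using that(3,4) \<open>p \<in> K\<close> unfolding det_def by blast
  qed
  have decomp: "D = (\<Union>f\<in>coord m ` D. cyl m f) \<and> coord m ` D \<subseteq> F m"
    if "D \<subseteq> K" "k \<le> m" "det m D" for D m
  proof -
    have *: "p \<in> stage m" "p \<in> cyl m (coord m p)" if "p \<in> D" for p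
      using that \<open>D \<subseteq> K\<close> stage_mono[OF _ \<open>k \<le> m\<close>, of p] by (auto simp: K_def cyl_eq)
    have "D = (\<Union>f\<in>coord m ` D. cyl m f)"
    proof
      show "D \<subseteq> (\<Union>f\<in>coord m ` D. cyl m f)"
        using *(2) by (intro subsetI UN_I[OF imageI])
      show "(\<Union>f\<in>coord m ` D. cyl m f) \<subseteq> D"
        by (intro UN_least, elim imageE, hypsubst) (rule cyl_sub[OF that])
    qed
    moreover have "coord m ` D \<subseteq> F m"
      using coord_F *(1) by auto
    ultimately show ?thesis
      by (rule conjI)
  qed
  have alg: "algebra K ?\<A>"
    unfolding algebra_iff_Un
  proof (intro conjI ballI)
    show "K - D \<in> ?\<A>" if "D \<in> ?\<A>" for D
      using that unfolding det_def by blast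
    fix D D' assume "D \<in> ?\<A>" "D' \<in> ?\<A>"
    then obtain m m' where m: "D \<subseteq> K" "k \<le> m" "det m D"
      and m': "D' \<subseteq> K" "k \<le> m'" "det m' D'"
      by blast
    have "det (max m m') D" "det (max m m') D'"
      using coord_down[OF _ _ m(2) max.cobounded1] coord_down[OF _ _ m'(2) max.cobounded2] m(3) m'(3)
      unfolding det_def by metis+
    then have "det (max m m') (D \<union> D')"
      unfolding det_def by blast
    then show "D \<union> D' \<in> ?\<A>"
      using m(1,2) m'(1) by (auto intro!: exI[of _ "max m m'"])
  qed (auto simp: det_def)
  have "sets ?M = (\<inter>) K ` sigma_sets (cf_space G C F) (cylinders k)"
    using sets_\<mu>[of k] by (simp add: sets_restrict_space)
  also have "\<dots> = sigma_sets K ((\<inter>) K ` cylinders k)"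
    using K_sets sets_\<mu>[of k] sets.sets_into_space[OF K_sets] by (intro sigma_sets_Int) (auto simp: space_\<mu>)
  finally have sets_M: "sets ?M = sigma_sets K ((\<inter>) K ` cylinders k)" .
  have gen: "sets ?M = sigma_sets K ?\<A>"
  proof
    have "K \<inter> D \<in> ?\<A>" if D: "D \<in> cylinders k" for D
    proof (cases "D = {}")
      case False
      then obtain m f where m: "D = cyl m f" "k \<le> m"
        using D by (auto simp: cylinders_def)
      then have "\<forall>p\<in>K. p \<in> stage m"
        using stage_mono by (auto simp: K_def cyl_eq)
      then have "det m (K \<inter> D)"
        using m by (auto simp: cyl_eq det_def)
      then show ?thesis
        using m by auto
    qed (auto simp: det_def)
    then show "sets ?M \<subseteq> sigma_sets K ?\<A>"
      unfolding sets_M by (intro sigma_sets_mono) (auto intro: sigma_sets.Basic)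
    have "D \<in> sets ?M" if D: "D \<in> ?\<A>" for D
    proof -
      obtain m where m: "D \<subseteq> K" "k \<le> m" "det m D"
        using D by blast
      have "(\<Union>f\<in>coord m ` D. cyl m f) \<in> sets \<mu>"
        using decomp[OF m] finite_subset[OF _ F_finite] by (intro sets.finite_UN) auto
      then show ?thesis
        using decomp[OF m] m(1) K_sets by (auto simp: sets_restrict_space_iff)
    qed
    then show "sigma_sets K ?\<A> \<subseteq> sets ?M"
      using sets.sigma_sets_subset[of ?\<A> ?M] space_M by auto
  qed
  have "K \<inter> E \<in> sets ?M"
    using E K_sets by (auto simp: sets_restrict_space_iff)
  \<comment> \<open>Let \<open>d\<close> be the measure of the symmetric difference and
    \<open>s\<close> that of \<open>D\<close>. Below, \<open>s \<le> e + d\<close> and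
    \<open>e \<le> (1 - \<delta>) * s + d\<close>; with \<open>d < \<delta> * e / 2\<close> these
    give \<open>e < e - \<delta> * \<delta> * e / 2\<close>, a contradiction.\<close>
  then obtain D where D: "D \<in> ?\<A>" "measure ?M ((K \<inter> E - D) \<union> (D - K \<inter> E)) < \<delta> * e / 2"
    using M.algebra_approximation[of ?\<A> "K \<inter> E" "\<delta> * e / 2"] alg gen \<delta> e unfolding space_M by auto
  then obtain m where m: "D \<subseteq> K" "k \<le> m" "det m D"
    by blast
  note dec = decomp[OF m]
  have fin: "finite (coord m ` D)"
    using dec finite_subset[OF _ F_finite] by blast
  have DM: "D \<in> sets ?M"
    using D gen by auto
  have D\<mu>: "D \<in> sets \<mu>"
    using DM K_sets by (auto simp: sets_restrict_space_iff)
  have meas: "measure ?M A = measure \<mu> A" if "A \<subseteq> K" for A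
    using K_sets that by (intro measure_restrict_space) auto
  define s where "s = (\<Sum>f\<in>coord m ` D. \<nu> m f)"
  have cover: "D = (\<Union>f\<in>coord m ` D. cyl m f)" "D \<inter> E = (\<Union>f\<in>coord m ` D. cyl m f \<inter> E)"
    using dec by auto
  have "measure \<mu> D = (\<Sum>f\<in>coord m ` D. measure \<mu> (cyl m f))"
    by (subst cover(1), rule measure_finite_Union[OF fin])
      (use fmeasurable_cyl in \<open>auto simp: disjoint_family_on_def cyl_eq fmeasurable_def less_top\<close>)
  also have "\<dots> = s"
    unfolding s_def using dec by (intro sum.cong) (auto simp: measure_cyl subset_iff)
  finally have mD: "measure ?M D = s"
    using meas m(1) by simp
  have "measure \<mu> (D \<inter> E) = (\<Sum>f\<in>coord m ` D. measure \<mu> (cyl m f \<inter> E))"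
    by (subst cover(2), rule measure_finite_Union[OF fin])
      (use fmeasurable_cyl_Int[OF E] E in \<open>auto simp: disjoint_family_on_def cyl_eq fmeasurable_def less_top\<close>)
  also have "\<dots> \<le> (\<Sum>f\<in>coord m ` D. (1 - \<delta>) * \<nu> m f)"
    using dec le by (intro sum_mono) auto
  also have "\<dots> = (1 - \<delta>) * s"
    by (simp add: s_def sum_distrib_left)
  finally have mDE: "measure ?M (D \<inter> E) \<le> (1 - \<delta>) * s"
    using meas[OF le_infI1[OF m(1), of E]] by simp
  let ?S = "(K \<inter> E - D) \<union> (D - K \<inter> E)"
  have DE: "D \<inter> E \<in> sets ?M"
    using DM E D\<mu> m(1) K_sets by (auto simp: sets_restrict_space_iff)
  have S: "?S \<in> sets ?M"
    using DM \<open>K \<inter> E \<in> sets ?M\<close> by auto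
  have "measure ?M D \<le> measure ?M ((K \<inter> E) \<union> ?S)"
    using DM \<open>K \<inter> E \<in> sets ?M\<close> S by (intro M.finite_measure_mono) auto
  also have "\<dots> \<le> measure ?M (K \<inter> E) + measure ?M ?S"
    using \<open>K \<inter> E \<in> sets ?M\<close> S by (intro measure_Un_le) auto
  finally have 1: "s \<le> e + measure ?M ?S"
    using mD meas[of "K \<inter> E"] by (simp add: e_def)
  have "measure ?M (K \<inter> E) \<le> measure ?M ((D \<inter> E) \<union> ?S)"
    using DE S by (intro M.finite_measure_mono) auto
  also have "\<dots> \<le> measure ?M (D \<inter> E) + measure ?M ?S"
    using DE S by (intro measure_Un_le) auto
  finally have 2: "e \<le> (1 - \<delta>) * s + measure ?M ?S"
    using mDE meas[of "K \<inter> E"] by (simp add: e_def)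
  have "(1 - \<delta>) * s \<le> (1 - \<delta>) * (e + \<delta> * e / 2)"
    using 1 D(2) \<delta> by (intro mult_left_mono) auto
  then have "e < (1 - \<delta>) * (e + \<delta> * e / 2) + \<delta> * e / 2"
    using 2 D(2) by linarith
  also have "\<dots> = e - \<delta> * \<delta> * e / 2"
    by (simp add: field_simps)
  finally show False
    using mult_pos_pos[OF mult_pos_pos[OF \<delta>(1) \<delta>(1)] e] by linarith
qed

end


section \<open>Fibers of the equivariant map\<close>

lemma (in group) r_coset_mult_iff:
  "U \<subseteq> carrier G \<Longrightarrow> f \<in> carrier G \<Longrightarrow> g \<in> carrier G \<Longrightarrow> g \<otimes> f \<in> U #> f \<longleftrightarrow> g \<in> U"
  unfolding r_coset_def by (auto simp: subset_iff)

lemma (in group) mem_r_coset_iff: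
  assumes "U \<subseteq> carrier G" "f \<in> carrier G" "k \<in> carrier G"
  shows "k \<in> U #> f \<longleftrightarrow> k \<otimes> inv f \<in> U"
  using r_coset_mult_iff[of U f "k \<otimes> inv f"] assms by (simp add: m_assoc)

text \<open>For a subgroup \<open>H\<close> these are the unions of right cosets of
  \<open>H\<close>. They will be the possible values of the map sending \<open>p\<close> to the set
  of \<open>g\<close> with \<open>act g p \<in> A\<close>.\<close>

definition (in group) left_invariant_sets :: "'a set \<Rightarrow> 'a set set" where
  "left_invariant_sets H = {U. U \<subseteq> carrier G \<and> (\<forall>h\<in>H. \<forall>u\<in>U. h \<otimes> u \<in> U)}"

text \<open>Such a set is the union of the right cosets that it contains, so a subset of the finite
  set \<open>rcosets H\<close> determines it.\<close>

lemma (in group) finite_left_invariant_sets: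
  assumes H: "subgroup H G" and fin: "finite (rcosets H)"
  shows "finite (left_invariant_sets H)"
proof (rule finite_subset)
  show "left_invariant_sets H \<subseteq> Union ` Pow (rcosets H)"
  proof
    fix U assume U: "U \<in> left_invariant_sets H"
    have "U = \<Union>{R \<in> rcosets H. R \<subseteq> U}"
    proof
      show "U \<subseteq> \<Union>{R \<in> rcosets H. R \<subseteq> U}"
      proof
        fix u assume u: "u \<in> U"
        then have "H #> u \<subseteq> U" "u \<in> carrier G"
          using U by (auto simp: left_invariant_sets_def r_coset_def)
        then show "u \<in> \<Union>{R \<in> rcosets H. R \<subseteq> U}"
          using rcos_self[OF _ H, of u] subgroup.subset[OF H] rcosetsI by blast
      qed
    qed blast
    then show "U \<in> Union ` Pow (rcosets H)"
      by blast
  qed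
qed (use fin in auto)

lemma (in group) left_invariant_r_coset:
  assumes "U \<in> left_invariant_sets H" "H \<subseteq> carrier G" "f \<in> carrier G"
  shows "U #> f \<in> left_invariant_sets H"
  using assms unfolding left_invariant_sets_def r_coset_def
  by (auto simp: subset_iff m_assoc[symmetric])

definition (in group) right_stabilizer :: "'a set \<Rightarrow> 'a set" where
  "right_stabilizer U = {g \<in> carrier G. U #> g = U}"

lemma (in group) subgroup_right_stabilizer:
  assumes U: "U \<subseteq> carrier G"
  shows "subgroup (right_stabilizer U) G"
proof
  show "inv x \<in> right_stabilizer U" if "x \<in> right_stabilizer U" for x
  proof -
    have "x \<in> carrier G" "U #> x = U"
      using that by (auto simp: right_stabilizer_def)
    then show ?thesis
      using coset_mult_assoc[OF U, of x "inv x"] coset_mult_one[OF U] by (simp add: right_stabilizer_def)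
  qed
qed (use U in \<open>auto simp: right_stabilizer_def coset_mult_assoc[symmetric]\<close>)

text \<open>Orbit and stabilizer: the right coset of \<open>x\<close> consists of all
  \<open>g\<close> with \<open>U #> g = U #> x\<close>, and these translates lie in the finite set
  \<open>left_invariant_sets H\<close>.\<close>

lemma (in group) finite_rcosets_right_stabilizer:
  assumes H: "subgroup H G" and fin: "finite (rcosets H)" and U: "U \<in> left_invariant_sets H"
  shows "finite (rcosets (right_stabilizer U))"
proof (rule finite_subset)
  have Uc: "U \<subseteq> carrier G"
    using U by (simp add: left_invariant_sets_def)
  show "rcosets (right_stabilizer U) \<subseteq> (\<lambda>V. {g \<in> carrier G. U #> g = V}) ` left_invariant_sets H"
  proof
    fix R assume "R \<in> rcosets (right_stabilizer U)"
    then obtain x where x: "x \<in> carrier G" "R = right_stabilizer U #> x"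
      by (auto simp: RCOSETS_def)
    have "g \<in> right_stabilizer U #> x \<longleftrightarrow> U #> g = U #> x" if g: "g \<in> carrier G" for g
    proof -
      have "g \<in> right_stabilizer U #> x \<longleftrightarrow> U #> (g \<otimes> inv x) = U"
        using mem_r_coset_iff[of "right_stabilizer U" x g] x g by (auto simp: right_stabilizer_def)
      also have "\<dots> \<longleftrightarrow> U #> g = U #> x"
        using coset_mult_assoc[OF Uc, of g "inv x"] coset_mult_assoc[OF Uc, of x "inv x"]
          coset_mult_assoc[OF Uc, of "g \<otimes> inv x" x] x g coset_mult_one[OF Uc]
        by (metis inv_closed l_inv m_assoc m_closed r_inv r_one)
      finally show ?thesis .
    qed
    moreover have "right_stabilizer U #> x \<subseteq> carrier G"
      using x r_coset_subset_G[of "right_stabilizer U" x] by (auto simp: right_stabilizer_def)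
    ultimately have "R = {g \<in> carrier G. U #> g = U #> x}"
      using x by blast
    moreover have "U #> x \<in> left_invariant_sets H"
      using left_invariant_r_coset[OF U subgroup.subset[OF H] x(1)] .
    ultimately show "R \<in> (\<lambda>V. {g \<in> carrier G. U #> g = V}) ` left_invariant_sets H"
      by blast
  qed
qed (use finite_left_invariant_sets[OF H fin] in auto)

section \<open>Fibers and their conditional probabilities on cylinders\<close>

context cf_measured
begin

text \<open>A level set of the map that records at which group elements the orbit of
  \<open>p\<close> visits \<open>A\<close>. It is restricted to \<open>full_domain\<close>, where
  all translations are defined.\<close>

definition fiber :: "'a cf_point set \<Rightarrow> 'a set \<Rightarrow> 'a cf_point set" where
  "fiber A U = {p \<in> full_domain. {g \<in> carrier G. act g p \<in> A} = U}"

lemma fiber_sets [measurable]: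
  assumes A: "A \<in> sets \<mu>"
  shows "fiber A U \<in> sets \<mu>"
proof (cases "U \<subseteq> carrier G")
  case True
  have "{p \<in> full_domain. act g p \<in> A \<longleftrightarrow> g \<in> U} \<in> sets \<mu>" if g: "g \<in> carrier G" for g
  proof (cases "g \<in> U")
    case True
    then show ?thesis
      using act_vimage_sets[OF g A] by simp
  next
    case False
    then have "{p \<in> full_domain. act g p \<in> A \<longleftrightarrow> g \<in> U} = full_domain - {p \<in> full_domain. act g p \<in> A}"
      by auto
    then show ?thesis
      using act_vimage_sets[OF g A] by simp
  qed
  then have "(\<Inter>g\<in>carrier G. {p \<in> full_domain. act g p \<in> A \<longleftrightarrow> g \<in> U}) \<in> sets \<mu>"
    using countable_carrier one_closed by (intro sets.countable_INT') auto
  also have "(\<Inter>g\<in>carrier G. {p \<in> full_domain. act g p \<in> A \<longleftrightarrow> g \<in> U}) = fiber A U"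
    using True one_closed unfolding fiber_def by blast
  finally show ?thesis .
next
  case False
  then have "fiber A U = {}"
    by (auto simp: fiber_def)
  then show ?thesis
    by simp
qed

text \<open>Substituting \<open>k = g \<otimes> f\<close> in
  \<open>act g (act f p) = act (g \<otimes> f) p\<close> shows that moving \<open>p\<close> by
  \<open>f\<close> multiplies its set of visits on the right by \<open>inv f\<close>. On
  \<open>cyl n \<one>\<close> the translation by \<open>f\<close> can be undone, so
  \<open>full_domain\<close> is respected in both directions.\<close>

lemma act_mem_fiber_iff:
  assumes p: "p \<in> cyl n \<one>" and f: "f \<in> F n" and U: "U \<subseteq> carrier G"
  shows "act f p \<in> fiber A U \<longleftrightarrow> p \<in> fiber A (U #> f)"
proof -
  have fc: "f \<in> carrier G" and f1: "f \<otimes> \<one> \<in> F n"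
    using f F_carrier by auto
  have dom: "act f p \<in> full_domain \<longleftrightarrow> p \<in> full_domain"
    using act_full_domain[of p f] act_full_domain[of "act f p" "inv f"] act_cyl(3)[OF fc p f1] fc by auto
  have Collect_eq: "{g \<in> carrier G. P g} = V \<longleftrightarrow> (\<forall>g\<in>carrier G. P g \<longleftrightarrow> g \<in> V)" if "V \<subseteq> carrier G" for P V
    using that by blast
  show ?thesis
  proof (cases "p \<in> full_domain")
    case True
    have "{g \<in> carrier G. act g (act f p) \<in> A} = U \<longleftrightarrow> (\<forall>g\<in>carrier G. act (g \<otimes> f) p \<in> A \<longleftrightarrow> g \<in> U)"
      using Collect_eq[OF U] act_mult[OF True fc] by simp
    also have "\<dots> \<longleftrightarrow> (\<forall>k\<in>carrier G. act k p \<in> A \<longleftrightarrow> k \<in> U #> f)"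
    proof
      assume *: "\<forall>g\<in>carrier G. act (g \<otimes> f) p \<in> A \<longleftrightarrow> g \<in> U"
      show "\<forall>k\<in>carrier G. act k p \<in> A \<longleftrightarrow> k \<in> U #> f"
      proof
        fix k assume k: "k \<in> carrier G"
        then show "act k p \<in> A \<longleftrightarrow> k \<in> U #> f"
          using *[rule_format, of "k \<otimes> inv f"] mem_r_coset_iff[OF U fc k] fc by (simp add: m_assoc)
      qed
    next
      assume "\<forall>k\<in>carrier G. act k p \<in> A \<longleftrightarrow> k \<in> U #> f"
      then show "\<forall>g\<in>carrier G. act (g \<otimes> f) p \<in> A \<longleftrightarrow> g \<in> U"
        using r_coset_mult_iff[OF U fc] fc by simp
    qed
    also have "\<dots> \<longleftrightarrow> {k \<in> carrier G. act k p \<in> A} = U #> f"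
      using Collect_eq[OF r_coset_subset_G[OF U fc]] by simp
    finally have "{g \<in> carrier G. act g (act f p) \<in> A} = U \<longleftrightarrow> {k \<in> carrier G. act k p \<in> A} = U #> f" .
    then show ?thesis
      using True dom by (simp add: fiber_def)
  qed (use dom in \<open>simp add: fiber_def\<close>)
qed

definition fiber_prob :: "'a cf_point set \<Rightarrow> nat \<Rightarrow> 'a set \<Rightarrow> real" where
  "fiber_prob A n U = measure \<mu> (cyl n \<one> \<inter> fiber A U) / \<nu> n \<one>"

lemma fiber_prob_nonneg: "0 \<le> fiber_prob A n U"
  using \<nu>_support[OF one_F, of n] by (simp add: fiber_prob_def)

text \<open>\<open>act f\<close> carries \<open>cyl n \<one>\<close> to \<open>cyl n f\<close> with
  a constant scaling factor, and the preimage of \<open>fiber A U\<close> is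
  \<open>fiber A (U #> f)\<close>. So the densities on all cylinders of level \<open>n\<close> can
  be read off at the identity.\<close>

lemma measure_cyl_fiber:
  assumes A: "A \<in> sets \<mu>" and f: "f \<in> F n" and U: "U \<subseteq> carrier G"
  shows "measure \<mu> (cyl n f \<inter> fiber A U) = \<nu> n f * fiber_prob A n (U #> f)"
proof -
  have fc: "f \<in> carrier G"
    using f F_carrier by blast
  have "{p \<in> cyl n \<one>. act f p \<in> fiber A U} = cyl n \<one> \<inter> fiber A (U #> f)"
    using act_mem_fiber_iff[OF _ f U] by blast
  then show ?thesis
    using act_scaling[OF fc one_F _ fiber_sets[OF A], of n U] f fc \<nu>_support[OF one_F, of n]
    by (simp add: fiber_prob_def field_simps)
qed

lemma fiber_prob_disjoint:
  assumes A: "A \<in> sets \<mu>" and "U \<noteq> V"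
  shows "fiber_prob A n U + fiber_prob A n V \<le> 1"
proof -
  have "measure \<mu> (cyl n \<one> \<inter> fiber A U) + measure \<mu> (cyl n \<one> \<inter> fiber A V)
      = measure \<mu> (cyl n \<one> \<inter> fiber A U \<union> cyl n \<one> \<inter> fiber A V)"
    using fmeasurable_cyl_Int[OF fiber_sets[OF A]] assms
    by (intro measure_Union[symmetric])
      (auto simp: fmeasurable_def less_top fiber_def)
  also have "\<dots> \<le> measure \<mu> (cyl n \<one>)"
    using A by (intro measure_mono_fmeasurable fmeasurable_cyl) auto
  finally show ?thesis
    using \<nu>_support[OF one_F, of n]
    by (simp add: fiber_prob_def measure_cyl[OF one_F] field_simps)
qed

lemma fiber_prob_le_1:
  assumes A: "A \<in> sets \<mu>"
  shows "fiber_prob A n U \<le> 1"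
proof -
  have "measure \<mu> (cyl n \<one> \<inter> fiber A U) \<le> measure \<mu> (cyl n \<one>)"
    using A by (intro measure_mono_fmeasurable fmeasurable_cyl) auto
  then show ?thesis
    using \<nu>_support[OF one_F, of n] by (simp add: fiber_prob_def measure_cyl[OF one_F])
qed

text \<open>\<open>cyl n \<one>\<close> splits into the cylinders \<open>cyl (Suc n) c\<close>,
  whose relative masses are the weights \<open>pmf (\<kappa> (Suc n)) c\<close>.\<close>

lemma fiber_prob_Suc:
  assumes A: "A \<in> sets \<mu>" and U: "U \<subseteq> carrier G"
  shows "fiber_prob A n U = (\<Sum>c\<in>C (Suc n). pmf (\<kappa> (Suc n)) c * fiber_prob A (Suc n) (U #> c))"
proof -
  have "cyl n \<one> \<inter> fiber A U = (\<Union>c\<in>C (Suc n). cyl (Suc n) c \<inter> fiber A U)"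
    using cyl_Suc[OF one_F, of n] C_carrier by auto
  then have "measure \<mu> (cyl n \<one> \<inter> fiber A U) = measure \<mu> (\<Union>c\<in>C (Suc n). cyl (Suc n) c \<inter> fiber A U)"
    by simp
  also have "\<dots> = (\<Sum>c\<in>C (Suc n). measure \<mu> (cyl (Suc n) c \<inter> fiber A U))"
    using fmeasurable_cyl_Int[OF fiber_sets[OF A]] A C_finite[of "Suc n"]
    by (intro measure_finite_Union) (auto simp: disjoint_family_on_def cyl_eq fmeasurable_def less_top)
  also have "\<dots> = (\<Sum>c\<in>C (Suc n). \<nu> n \<one> * (pmf (\<kappa> (Suc n)) c * fiber_prob A (Suc n) (U #> c)))"
  proof (rule sum.cong)
    fix c assume c: "c \<in> C (Suc n)"
    then have "c \<in> F (Suc n)" "\<nu> (Suc n) c = \<nu> n \<one> * pmf (\<kappa> (Suc n)) c"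
      using F_C_mult[OF one_F c] \<nu>_Suc[OF one_F c] C_carrier[OF c] by auto
    then show "measure \<mu> (cyl (Suc n) c \<inter> fiber A U)
        = \<nu> n \<one> * (pmf (\<kappa> (Suc n)) c * fiber_prob A (Suc n) (U #> c))"
      using measure_cyl_fiber[OF A _ U] by simp
  qed simp
  also have "\<dots> = \<nu> n \<one> * (\<Sum>c\<in>C (Suc n). pmf (\<kappa> (Suc n)) c * fiber_prob A (Suc n) (U #> c))"
    by (simp add: sum_distrib_left)
  finally show ?thesis
    using \<nu>_support[OF one_F, of n] fiber_prob_def[of A n U] by simp
qed

lemma sum_\<kappa>: "(\<Sum>c\<in>C (Suc n). pmf (\<kappa> (Suc n)) c) = 1"
  using C_finite[of "Suc n"] \<kappa>_support[of "Suc n"] by (intro sum_pmf_eq_1) auto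

section \<open>Averaging over convolution products\<close>

lemma convolution_product_self: "convolution_product G \<kappa> n n = return_pmf \<one>"
  by (simp add: convolution_product_def)

lemma convolution_product_Suc:
  "n < m \<Longrightarrow> convolution_product G \<kappa> n m = convolve_pmf G (\<kappa> (Suc n)) (convolution_product G \<kappa> (Suc n) m)"
  unfolding convolution_product_def by (subst upt_conv_Cons) auto

lemma set_convolution_product:
  "n \<le> m \<Longrightarrow> set_pmf (convolution_product G \<kappa> n m) \<subseteq> carrier G"
proof (induction n rule: inc_induct)
  case base
  then show ?case by (simp add: convolution_product_self)
next
  case (step n)
  then show ?case
    using \<kappa>_support[of "Suc n"] C_carrier[of _ n]
    by (auto simp: convolution_product_Suc convolve_pmf_def subset_iff)
qed

text \<open>Iteration of \<open>fiber_prob_Suc\<close>. The induction runs downwards in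
  \<open>n\<close> because the convolution product sheds its leftmost factor \<open>c\<close>, and
  \<open>U\<close> is kept arbitrary because the induction hypothesis is needed for
  \<open>U #> c\<close>.\<close>

lemma fiber_prob_convolution:
  assumes A: "A \<in> sets \<mu>" and "U \<subseteq> carrier G" "n \<le> m"
  shows "ennreal (fiber_prob A n U) =
    (\<integral>\<^sup>+f. ennreal (fiber_prob A m (U #> f)) \<partial>measure_pmf (convolution_product G \<kappa> n m))"
  using assms(3,2)
proof (induction n arbitrary: U rule: inc_induct)
  case base
  then show ?case
    by (simp add: convolution_product_self coset_mult_one)
next
  case (step n)
  let ?q = "convolution_product G \<kappa> (Suc n) m"
  have "(\<integral>\<^sup>+f. ennreal (fiber_prob A m (U #> f)) \<partial>measure_pmf (convolution_product G \<kappa> n m))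
      = (\<integral>\<^sup>+c. \<integral>\<^sup>+f. ennreal (fiber_prob A m (U #> (c \<otimes> f))) \<partial>measure_pmf ?q \<partial>measure_pmf (\<kappa> (Suc n)))"
    using step by (simp add: convolution_product_Suc convolve_pmf_def nn_integral_pair_pmf')
  also have "\<dots> = (\<integral>\<^sup>+c. ennreal (fiber_prob A (Suc n) (U #> c)) \<partial>measure_pmf (\<kappa> (Suc n)))"
  proof (rule nn_integral_cong_AE, rule AE_pmfI)
    fix c assume "c \<in> set_pmf (\<kappa> (Suc n))"
    then have c: "c \<in> carrier G"
      using \<kappa>_support[of "Suc n"] C_carrier by auto
    have "(\<integral>\<^sup>+f. ennreal (fiber_prob A m (U #> (c \<otimes> f))) \<partial>measure_pmf ?q)
        = (\<integral>\<^sup>+f. ennreal (fiber_prob A m (U #> c #> f)) \<partial>measure_pmf ?q)"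
      using set_convolution_product[of "Suc n" m] step c
      by (intro nn_integral_cong_AE AE_pmfI) (auto simp: coset_mult_assoc)
    then show "(\<integral>\<^sup>+f. ennreal (fiber_prob A m (U #> (c \<otimes> f))) \<partial>measure_pmf ?q) = ennreal (fiber_prob A (Suc n) (U #> c))"
      using step.IH[of "U #> c"] r_coset_subset_G[OF step.prems c] by simp
  qed
  also have "\<dots> = (\<Sum>c\<in>C (Suc n). ennreal (fiber_prob A (Suc n) (U #> c)) * ennreal (pmf (\<kappa> (Suc n)) c))"
    using \<kappa>_support[of "Suc n"] C_finite[of "Suc n"] by (subst nn_integral_measure_pmf_finite) auto
  also have "\<dots> = ennreal (\<Sum>c\<in>C (Suc n). pmf (\<kappa> (Suc n)) c * fiber_prob A (Suc n) (U #> c))"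
    by (subst sum_ennreal[symmetric]) (auto simp: fiber_prob_nonneg ennreal_mult' mult.commute)
  finally show ?case
    using fiber_prob_Suc[OF A step.prems] by simp
qed


section \<open>Invariant sets\<close>

text \<open>Invariance at every point, not only almost everywhere, makes the set of visits of each
  point of \<open>A\<close> left invariant under \<open>H\<close>, so only finitely many values
  occur on \<open>A\<close>. The hypothesis \<open>compat\<close> is applied to the stabilizer of
  the value on which the probabilities concentrate.\<close>

lemma invariant_conull:
  assumes A: "A \<in> sets \<mu>" "A \<subseteq> full_domain"
    and H: "subgroup H G" "finite (rcosets H)"
    and inv: "\<And>h p. h \<in> H \<Longrightarrow> p \<in> A \<Longrightarrow> act h p \<in> A"
    and compat: "\<And>\<Gamma> n. subgroup \<Gamma> G \<Longrightarrow> \<Gamma> \<noteq> carrier G \<Longrightarrow> finite (rcosets \<Gamma>) \<Longrightarrow>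
      strict_mono (n :: nat \<Rightarrow> nat) \<Longrightarrow> 0 < n 0 \<Longrightarrow>
      (\<Sum>k. emeasure (measure_pmf (convolution_product G \<kappa> (n k) (n (Suc k))))
         {c \<in> set_product G C (n k) (n (Suc k)). c \<notin> \<Gamma>}) = \<infinity>"
    and nonnull: "A \<notin> null_sets \<mu>"
  shows "space \<mu> - A \<in> null_sets \<mu>"
proof -
  let ?\<U> = "left_invariant_sets H"
  let ?P = "fiber_prob A"
  note HG = subgroup.subset[OF H(1)]
  have fin: "finite ?\<U>"
    using finite_left_invariant_sets[OF H] .
  have \<U>_carrier: "U \<subseteq> carrier G" if "U \<in> ?\<U>" for U
    using that by (simp add: left_invariant_sets_def)

  have "A \<subseteq> (\<Union>U\<in>?\<U>. fiber A U)"
  proof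
    fix p assume p: "p \<in> A"
    then have pd: "p \<in> full_domain"
      using A by blast
    have "h \<otimes> g \<in> {g \<in> carrier G. act g p \<in> A}" if "h \<in> H" "g \<in> {g \<in> carrier G. act g p \<in> A}" for h g
    proof -
      have "h \<in> carrier G" "g \<in> carrier G" "act g p \<in> A"
        using that HG by auto
      then show ?thesis
        using act_mult[OF pd, of g h] inv[OF that(1), of "act g p"] by simp
    qed
    then have "{g \<in> carrier G. act g p \<in> A} \<in> ?\<U>"
      unfolding left_invariant_sets_def by blast
    then show "p \<in> (\<Union>U\<in>?\<U>. fiber A U)"
      using pd by (auto simp: fiber_def)
  qed
  then have A_eq: "A = (\<Union>U\<in>?\<U>. fiber A U \<inter> A)"
    by blast
  have "\<exists>U\<in>?\<U>. fiber A U \<inter> A \<notin> null_sets \<mu>"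
  proof (rule ccontr)
    assume "\<not> ?thesis"
    then have "(\<Union>U\<in>?\<U>. fiber A U \<inter> A) \<in> null_sets \<mu>"
      using fin by (intro null_sets.finite_UN) auto
    then show False
      using nonnull A_eq by simp
  qed
  then obtain V where V: "V \<in> ?\<U>" "fiber A V \<inter> A \<notin> null_sets \<mu>"
    by blast
  then have V': "fiber A V \<notin> null_sets \<mu>"
    using null_set_Int2[OF _ A(1)] by blast

  \<comment> \<open>\<open>density\<close> gives a cylinder on which one value dominates. The bound
    survives at all later levels: a probability at level \<open>n\<close> is an average of
    probabilities at level \<open>Suc n\<close>, so one of these exceeds the bound too. The
    dominating set may change with the level.\<close>
  have conc: "\<exists>N. \<forall>n\<ge>N. \<exists>U\<in>?\<U>. 1 - \<delta> < ?P n U" if \<delta>: "0 < \<delta>" "\<delta> < 1" for \<delta> :: real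
  proof -
    obtain N f where f: "f \<in> F N" "(1 - \<delta>) * \<nu> N f < measure \<mu> (cyl N f \<inter> fiber A V)"
      using density[OF fiber_sets[OF A(1)] V' \<delta>] .
    then have "\<nu> N f * (1 - \<delta>) < \<nu> N f * ?P N (V #> f)"
      using measure_cyl_fiber[OF A(1) f(1) \<U>_carrier[OF V(1)]] by (simp add: mult.commute)
    then have N: "1 - \<delta> < ?P N (V #> f)"
      using \<nu>_support[OF f(1)] by simp
    have "\<exists>U\<in>?\<U>. 1 - \<delta> < ?P n U" if "N \<le> n" for n
      using that
    proof (induction n rule: dec_induct)
      case base
      then show ?case
        using N left_invariant_r_coset[OF V(1) HG F_carrier[OF f(1)]] by blast
    next
      case (step n)
      then obtain U where U: "U \<in> ?\<U>" "1 - \<delta> < ?P n U"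
        by blast
      have "\<exists>c\<in>C (Suc n). 1 - \<delta> < ?P (Suc n) (U #> c)"
      proof (rule ccontr)
        assume "\<not> ?thesis"
        then have "?P n U \<le> (\<Sum>c\<in>C (Suc n). pmf (\<kappa> (Suc n)) c * (1 - \<delta>))"
          unfolding fiber_prob_Suc[OF A(1) \<U>_carrier[OF U(1)]]
          by (intro sum_mono mult_left_mono) (auto simp: not_less)
        also have "\<dots> = 1 - \<delta>"
          by (simp add: sum_distrib_right[symmetric] sum_\<kappa>)
        finally show False
          using U by simp
      qed
      then show ?case
        using left_invariant_r_coset[OF U(1) HG C_carrier] by blast
    qed
    then show ?thesis
      by blast
  qed

  have "\<exists>a\<in>?\<U>. \<forall>\<delta>>0. \<forall>N. \<exists>n\<ge>N. 1 - \<delta> < ?P n a"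
  proof (rule ccontr)
    assume "\<not> ?thesis"
    then have "\<forall>a\<in>?\<U>. \<exists>\<delta>>0. \<exists>N. \<forall>n\<ge>N. ?P n a \<le> 1 - \<delta>"
      by (meson not_less)
    then obtain d M where dM: "\<And>a. a \<in> ?\<U> \<Longrightarrow> 0 < d a" "\<And>a n. a \<in> ?\<U> \<Longrightarrow> M a \<le> n \<Longrightarrow> ?P n a \<le> 1 - d a"
      by metis
    \<comment> \<open>If every set of the finite family stayed away from probability 1 from some
      level on, this single \<open>\<delta>\<close> would serve for all of them at one late level,
      against \<open>conc\<close>. The minimum with \<open>1 / 2\<close> keeps it below 1.\<close>
    define \<delta> where "\<delta> = min (1 / 2) (Min (d ` ?\<U>))"
    have "0 < Min (d ` ?\<U>)"
      using dM(1) fin V(1) by (subst Min_gr_iff) auto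
    then have \<delta>: "0 < \<delta>" "\<delta> < 1"
      by (auto simp: \<delta>_def)
    have \<delta>d: "\<delta> \<le> d a" if "a \<in> ?\<U>" for a
      using that fin by (auto simp: \<delta>_def min.coboundedI2)
    obtain N where N: "\<forall>n\<ge>N. \<exists>U\<in>?\<U>. 1 - \<delta> < ?P n U"
      using conc[OF \<delta>] by blast
    then obtain U where U: "U \<in> ?\<U>" "1 - \<delta> < ?P (max N (Max (M ` ?\<U>))) U"
      by (meson max.cobounded1)
    have "M U \<le> max N (Max (M ` ?\<U>))"
      using U(1) fin by (simp add: max.coboundedI2)
    then show False
      using dM(2)[OF U(1)] \<delta>d[OF U(1)] U(2) by force
  qed
  then obtain a where a: "a \<in> ?\<U>" and a_conc: "\<And>\<delta> N. 0 < \<delta> \<Longrightarrow> \<exists>n\<ge>N. 1 - \<delta> < ?P n a"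
    by blast
  note ac = \<U>_carrier[OF a]
  let ?\<Gamma> = "right_stabilizer a"

  have "?\<Gamma> = carrier G"
  proof (rule ccontr)
    assume proper: "?\<Gamma> \<noteq> carrier G"
    \<comment> \<open>For \<open>f\<close> outside the stabilizer, \<open>a #> f\<close> and
      \<open>a\<close> are different values, so at level \<open>m\<close> the first has probability
      at most \<open>1 / 2\<close>. Hence \<open>?P n a\<close> is at most 1 minus half the mass
      outside the stabilizer, and that mass is at most \<open>2 * \<epsilon>\<close>.\<close>
    have bound: "emeasure (measure_pmf (convolution_product G \<kappa> n m)) {c \<in> S. c \<notin> ?\<Gamma>} \<le> ennreal (2 * \<epsilon>)"
      if nm: "n \<le> m" and n: "1 - \<epsilon> < ?P n a" and m: "1 / 2 < ?P m a" for n m \<epsilon> S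
    proof -
      let ?q = "convolution_product G \<kappa> n m"
      have "ennreal (?P n a) = (\<integral>\<^sup>+f. ennreal (?P m (a #> f)) \<partial>measure_pmf ?q)"
        by (rule fiber_prob_convolution[OF A(1) ac nm])
      also have "\<dots> \<le> (\<integral>\<^sup>+f. indicator ?\<Gamma> f + ennreal (1 / 2) * indicator (- ?\<Gamma>) f \<partial>measure_pmf ?q)"
      proof (rule nn_integral_mono_AE, rule AE_pmfI)
        fix f assume "f \<in> set_pmf ?q"
        then have f: "f \<in> carrier G"
          using set_convolution_product[OF nm] by blast
        show "ennreal (?P m (a #> f)) \<le> indicator ?\<Gamma> f + ennreal (1 / 2) * indicator (- ?\<Gamma>) f"
        proof (cases "f \<in> ?\<Gamma>")
          case True
          then show ?thesis
            using fiber_prob_le_1[OF A(1)] by simp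
        next
          case False
          then have "a #> f \<noteq> a"
            using f by (auto simp: right_stabilizer_def)
          then have "?P m (a #> f) \<le> 1 / 2"
            using fiber_prob_disjoint[OF A(1), of "a #> f" a m] m by simp
          then have "ennreal (?P m (a #> f)) \<le> ennreal (1 / 2)"
            by (rule ennreal_leI)
          also have "\<dots> = indicator ?\<Gamma> f + ennreal (1 / 2) * indicator (- ?\<Gamma>) f"
            using False by simp
          finally show ?thesis .
        qed
      qed
      also have "\<dots> = emeasure (measure_pmf ?q) ?\<Gamma> + ennreal (1 / 2) * emeasure (measure_pmf ?q) (- ?\<Gamma>)"
        by (subst nn_integral_add) (auto simp: nn_integral_cmult_indicator)
      also have "\<dots> = ennreal (measure (measure_pmf ?q) ?\<Gamma> + 1 / 2 * measure (measure_pmf ?q) (- ?\<Gamma>))"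
        by (simp add: measure_pmf.emeasure_eq_measure ennreal_mult' del: times_divide_eq_left)
      finally have "?P n a \<le> measure (measure_pmf ?q) ?\<Gamma> + 1 / 2 * measure (measure_pmf ?q) (- ?\<Gamma>)"
        by (subst (asm) ennreal_le_iff) auto
      moreover have "measure (measure_pmf ?q) ?\<Gamma> = 1 - measure (measure_pmf ?q) (- ?\<Gamma>)"
        using measure_pmf.prob_compl[of ?\<Gamma> ?q] by (simp add: Compl_eq_Diff_UNIV)
      ultimately have "measure (measure_pmf ?q) (- ?\<Gamma>) \<le> 2 * \<epsilon>"
        using n by simp
      then have "emeasure (measure_pmf ?q) (- ?\<Gamma>) \<le> ennreal (2 * \<epsilon>)"
        by (simp add: measure_pmf.emeasure_eq_measure ennreal_leI)
      then show ?thesis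
        by (rule order_trans[rotated]) (intro emeasure_mono; auto)
    qed
    have late: "\<exists>m>N. 1 - (1 / 2) ^ k < ?P m a" for N k
      using a_conc[of "(1 / 2) ^ k" "Suc N"] by (auto simp: Suc_le_eq)
    \<comment> \<open>The telescoping: the defects \<open>1 - ?P (n k) a\<close> decay
      geometrically, so the bounds \<open>2 * \<epsilon>\<close> are summable. The exponent
      \<open>k + 2\<close> also keeps all probabilities above \<open>1 / 2\<close>, which
      \<open>bound\<close> asks for at the right end.\<close>
    have "\<exists>n. \<forall>k. (0 < n k \<and> 1 - (1 / 2) ^ (k + 2) < ?P (n k) a) \<and> n k < n (Suc k)"
    proof (rule dependent_nat_choice)
      show "\<exists>n. 0 < n \<and> 1 - (1 / 2) ^ (0 + 2) < ?P n a"
        using late[of 0 "0 + 2"] by blast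
      fix n k :: nat
      obtain m where "n < m" "1 - (1 / 2) ^ (Suc k + 2) < ?P m a"
        using late[of n "Suc k + 2"] by blast
      moreover from this have "0 < m"
        by linarith
      ultimately show "\<exists>m. (0 < m \<and> 1 - (1 / 2) ^ (Suc k + 2) < ?P m a) \<and> n < m"
        by blast
    qed
    then obtain n where n: "\<And>k. 0 < n k" "\<And>k. 1 - (1 / 2) ^ (k + 2) < ?P (n k) a" "\<And>k. n k < n (Suc k)"
      by blast
    have half: "1 / 2 < ?P (n k) a" for k
    proof -
      have "(1 / 2 :: real) ^ (k + 2) \<le> (1 / 2) ^ 1"
        by (rule power_decreasing) auto
      then show ?thesis
        using n(2)[of k] by simp
    qed
    have "(\<Sum>k. emeasure (measure_pmf (convolution_product G \<kappa> (n k) (n (Suc k))))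
         {c \<in> set_product G C (n k) (n (Suc k)). c \<notin> ?\<Gamma>}) \<le> (\<Sum>k. ennreal (2 * (1 / 2) ^ (k + 2)))"
      using n half by (intro suminf_le bound summableI less_imp_le) auto
    also have "\<dots> < \<infinity>"
    proof -
      have "summable (\<lambda>k. 2 * (1 / 2 :: real) ^ (k + 2))"
        by (simp add: power_add summable_geometric)
      then have "(\<Sum>k. ennreal (2 * (1 / 2) ^ (k + 2))) = ennreal (\<Sum>k. 2 * (1 / 2) ^ (k + 2))"
        by (intro suminf_ennreal2) auto
      then show ?thesis
        by (simp only: ennreal_less_top infinity_ennreal_def)
    qed
    finally have fin_sum: "(\<Sum>k. emeasure (measure_pmf (convolution_product G \<kappa> (n k) (n (Suc k))))
         {c \<in> set_product G C (n k) (n (Suc k)). c \<notin> ?\<Gamma>}) < \<infinity>" .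
    have "strict_mono n"
      using n(3) by (simp add: strict_mono_Suc_iff)
    then show False
      using compat[OF subgroup_right_stabilizer[OF ac] proper finite_rcosets_right_stabilizer[OF H a], of n]
        n(1) fin_sum by simp
  qed
  then have fixed: "a #> g = a" if "g \<in> carrier G" for g
    using that by (auto simp: right_stabilizer_def)

  \<comment> \<open>All translates of \<open>a\<close> coincide, so the convolution average is
    constant and \<open>?P n a\<close> equals every later \<open>?P m a\<close>; some of these are
    arbitrarily close to 1.\<close>
  have P1: "?P n a = 1" for n
  proof (rule antisym[OF fiber_prob_le_1[OF A(1)]], rule field_le_epsilon)
    fix \<epsilon> :: real assume "0 < \<epsilon>"
    then obtain m where m: "n \<le> m" "1 - \<epsilon> < ?P m a"
      using a_conc by blast
    have "ennreal (?P n a) = (\<integral>\<^sup>+f. ennreal (?P m a) \<partial>measure_pmf (convolution_product G \<kappa> n m))"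
      unfolding fiber_prob_convolution[OF A(1) ac m(1)] using set_convolution_product[OF m(1)] fixed
      by (intro nn_integral_cong_AE AE_pmfI) auto
    then have "?P n a = ?P m a"
      by (simp add: fiber_prob_nonneg)
    then show "1 \<le> ?P n a + \<epsilon>"
      using m by simp
  qed
  \<comment> \<open>Since \<open>a #> f = a\<close>, the probability 1 on
    \<open>cyl n \<one>\<close> transfers to every cylinder of level \<open>n\<close>.\<close>
  have "cyl n f - fiber A a \<in> null_sets \<mu>" if f: "f \<in> F n" for n f
  proof -
    have "measure \<mu> (cyl n f - fiber A a) = measure \<mu> (cyl n f) - measure \<mu> (cyl n f \<inter> fiber A a)"
      using measure_Diff[of \<mu> "cyl n f" "cyl n f \<inter> fiber A a"] fmeasurable_cyl[of n f] fiber_sets[OF A(1), of a]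
      by (auto simp: fmeasurable_def less_top Diff_Int)
    also have "\<dots> = 0"
      using measure_cyl_fiber[OF A(1) f ac] fixed[OF F_carrier[OF f]] P1 measure_cyl[OF f] by simp
    finally have "measure \<mu> (cyl n f - fiber A a) = 0" .
    moreover have "cyl n f - fiber A a \<in> fmeasurable \<mu>"
      using A by (intro fmeasurable_Diff fmeasurable_cyl) auto
    ultimately show ?thesis
      by (intro null_setsI) (simp_all add: emeasure_eq_measure2 fmeasurableD)
  qed
  then have "(\<Union>n. \<Union>f\<in>F n. cyl n f - fiber A a) \<in> null_sets \<mu>"
    using F_finite by (intro null_sets_UN null_sets.finite_UN)
  moreover have "(\<Union>n. \<Union>f\<in>F n. cyl n f - fiber A a) = space \<mu> - fiber A a"
    unfolding space_\<mu> space_eq_cyl by blast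
  ultimately have conull: "space \<mu> - fiber A a \<in> null_sets \<mu>"
    by simp

  \<comment> \<open>The set of visits of a point of \<open>A\<close> contains the identity. If
    \<open>a\<close> did not, \<open>A\<close> would lie in the null complement of its
    fiber.\<close>
  have "\<one> \<in> a"
  proof (rule ccontr)
    assume "\<one> \<notin> a"
    then have "A \<subseteq> space \<mu> - fiber A a"
      using A act_one sets.sets_into_space[OF A(1)] by (auto simp: fiber_def)
    then show False
      using null_sets_subset[OF conull A(1)] nonnull by blast
  qed
  then have "fiber A a \<subseteq> A"
    using act_one by (auto simp: fiber_def)
  then show "space \<mu> - A \<in> null_sets \<mu>"
    using null_sets_subset[OF conull, of "space \<mu> - A"] A by auto
qed

end

section \<open>Reduction of almost invariant sets to strictly invariant ones\<close>

theorem corollary2p6: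
  fixes G :: "('a, 'm) monoid_scheme"
    and C F :: "nat \<Rightarrow> 'a set" and \<kappa> :: "nat \<Rightarrow> 'a pmf" and \<nu> :: "nat \<Rightarrow> 'a \<Rightarrow> real"
    and \<mu> :: "'a cf_point measure"
  assumes "group G" and "countable (carrier G)" and "infinite (carrier G)"
    and "cf_parameters G C F \<kappa> \<nu>" and "cf_admissible G C F \<nu>"
    and "cf_measure G C F \<nu> \<mu>"
    and "\<And>\<Gamma> n. subgroup \<Gamma> G \<Longrightarrow> \<Gamma> \<noteq> carrier G \<Longrightarrow> finite (rcosets\<^bsub>G\<^esub> \<Gamma>) \<Longrightarrow>
           strict_mono (n :: nat \<Rightarrow> nat) \<Longrightarrow> 0 < n 0 \<Longrightarrow>
           suminf (\<lambda>k. emeasure (measure_pmf (convolution_product G \<kappa> (n k) (n (Suc k))))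
              {c \<in> set_product G C (n k) (n (Suc k)). c \<notin> \<Gamma>}) = \<infinity>"
  shows "totally_ergodic G (restrict_space \<mu> (cf_full_domain G C F)) (cf_action G C F)"
  unfolding totally_ergodic_def ergodic_action_def
proof (intro allI impI ballI, elim conjE)
  interpret cf_measured G C F \<kappa> \<nu> \<mu>
    using assms by (simp add: cf_measured_def cf_measured_axioms_def)
  let ?M = "restrict_space \<mu> full_domain"
  fix H B
  assume H: "subgroup H G" "finite (rcosets\<^bsub>G\<^esub> H)" and B: "B \<in> sets ?M"
    and inv: "\<forall>h\<in>H. AE p in ?M. act h p \<in> B \<longleftrightarrow> p \<in> B"
  note HG = subgroup.subset[OF H(1)]
  have space_M: "space ?M = full_domain"
    using sets.sets_into_space[OF full_domain_sets] by (auto simp: space_restrict_space)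
  have B\<mu>: "B \<in> sets \<mu>" "B \<subseteq> full_domain"
    using B by (auto simp: sets_restrict_space_iff)
  \<comment> \<open>\<open>A\<close> is a strictly invariant version of \<open>B\<close>: as
    \<open>H\<close> is countable, almost every point satisfies the invariance of \<open>B\<close>
    for all \<open>h\<close> at once, and there \<open>A\<close> and \<open>B\<close> agree.\<close>
  define A where "A = {p \<in> full_domain. \<forall>h\<in>H. act h p \<in> B}"
  have countable_H: "countable H"
    using countable_subset[OF HG countable_carrier] .
  have "A = (\<Inter>h\<in>H. {p \<in> full_domain. act h p \<in> B})"
    using subgroup.one_closed[OF H(1)] by (auto simp: A_def)
  also have "\<dots> \<in> sets \<mu>"
    using countable_H subgroup.one_closed[OF H(1)] act_vimage_sets[OF _ B\<mu>(1)] HG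
    by (intro sets.countable_INT') auto
  finally have A: "A \<in> sets \<mu>" .
  have "AE p in ?M. \<forall>h\<in>H. act h p \<in> B \<longleftrightarrow> p \<in> B"
    using inv countable_H by (simp add: AE_ball_countable)
  then have AB: "AE p in ?M. p \<in> B \<longleftrightarrow> p \<in> A"
    using AE_space
  proof eventually_elim
    case (elim p)
    then show ?case
      using subgroup.one_closed[OF H(1)] act_one[of p] unfolding A_def space_M by auto
  qed
  have inv_A: "act h p \<in> A" if h: "h \<in> H" and p: "p \<in> A" for h p
  proof -
    have "act h' (act h p) \<in> B" if h': "h' \<in> H" for h'
    proof -
      have "act h' (act h p) = act (h' \<otimes>\<^bsub>G\<^esub> h) p"
        using p h h' HG by (intro act_mult) (auto simp: A_def)
      then show ?thesis
        using p subgroup.m_closed[OF H(1) h' h] by (simp add: A_def)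
    qed
    then show ?thesis
      using p h HG act_full_domain by (auto simp: A_def)
  qed
  have "space \<mu> - A \<in> null_sets \<mu>" if "A \<notin> null_sets \<mu>"
  proof (rule invariant_conull[OF A _ H])
    show "A \<subseteq> full_domain"
      by (auto simp: A_def)
  qed (fact inv_A assms(7) that)+
  then have "A \<in> null_sets \<mu> \<or> space \<mu> - A \<in> null_sets \<mu>"
    by blast
  then have "A \<in> null_sets ?M \<or> full_domain - A \<in> null_sets ?M"
  proof
    assume "A \<in> null_sets \<mu>"
    then show ?thesis
      by (auto simp: null_sets_restrict_space A_def)
  next
    assume "space \<mu> - A \<in> null_sets \<mu>"
    moreover have "full_domain - A \<subseteq> space \<mu> - A" "full_domain - A \<in> sets \<mu>"
      using sets.sets_into_space[OF full_domain_sets] A by auto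
    ultimately have "full_domain - A \<in> null_sets \<mu>"
      by (meson null_sets_subset)
    then show ?thesis
      by (auto simp: null_sets_restrict_space)
  qed
  \<comment> \<open>The dichotomy passes from \<open>A\<close> to \<open>B\<close> in the form of
    almost-everywhere statements, since the two sets agree only up to a null set.\<close>
  then have "(AE p in ?M. p \<notin> A) \<or> (AE p in ?M. p \<notin> full_domain - A)"
    using AE_not_in by blast
  then have "(AE p in ?M. p \<notin> B) \<or> (AE p in ?M. p \<notin> full_domain - B)"
  proof
    assume "AE p in ?M. p \<notin> A"
    then have "AE p in ?M. p \<notin> B"
      using AB by eventually_elim simp
    then show ?thesis ..
  next
    assume "AE p in ?M. p \<notin> full_domain - A"
    then have "AE p in ?M. p \<notin> full_domain - B"
      using AB by eventually_elim auto
    then show ?thesis ..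
  qed
  then show "B \<in> null_sets ?M \<or> space ?M - B \<in> null_sets ?M"
    using B space_M sets.compl_sets[OF B] by (simp add: AE_iff_null_sets)
qed

end
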